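(* For unfeatured graphs, diagonally augmented SPE-APE-GT is at least as strong as $RD$-RPE-GT. Precisely: there exists a choice of DeepSets function $f$ such that for any two unfeatured graphs $G$ and $H$, if $G$ and $H$ are indistinguishable by all $\phi$-APE-GTs for every absolute positional encoding (APE) of the form $\phi=g\big(I,\,V\operatorname{diag}(f(\Lambda))V^T\big)$ with $g$ a 2-EGN, then $G$ and $H$ are indistinguishable by all $RD$-RPE-GTs, where $RD$ is the resistance distance.
   Context: Graphs are finite, simple, undirected and unweighted. An unfeatured graph is treated as having node features $X_G$ constantly equal to $1$. An APE $\phi$ assigns each graph $G$ a map $\phi_G:V_G\to\mathbb{R}^l$ with $\phi_G=\phi_H\circ\sigma$ for every graph isomorphism $\sigma:V_G\to V_H$. An RPE $\psi$ assigns each graph $G$ a map $\psi_G:V_G\times V_G\to\mathbb{R}^k$ with $\psi_G=\psi_H\circ(\sigma\times\sigma)$ for every graph isomorphism $\sigma$. $L=D-A$ is the graph Laplacian of a graph with $n$ vertices, with eigenvalues $\Lambda=(\lambda_1\le\dots\le\lambda_n)$ and an orthonormal eigenbasis forming the columns of $V\in\mathbb{R}^{n\times n}$, so $L=V\operatorname{diag}(\Lambda)V^T$. $L^\dagger$ is the pseudoinverse of $L$, and the resistance distance is the RPE $RD(u,v)=L^\dagger(u,u)+L^\dagger(v,v)-2L^\dagger(u,v)$. The SPE positional encoding is $\mathrm{SPE}(V,\Lambda)=g(V\operatorname{diag}(f(\Lambda))V^T)$, with $g$ a 2-EGN and $f:\mathbb{R}^n\to\mathbb{R}^n$ (for each $n$)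 a permutation-equivariant function of DeepSets type, i.e. $f(\Lambda)_i=\rho(\lambda_i,\sum_j\eta(\lambda_j))$ for functions $\rho,\eta$ independent of $n$ (entrywise functions of the $\lambda_i$ are a special case). Diagonal augmentation means stacking the identity matrix $I$ to the matrix given as input to $g$. 2-EGN (second order equivariant graph network) with node output: a function $g:\mathbb{R}^{n^2\times k}\to\mathbb{R}^{n\times l}$ of the form $g=h\circ m\circ L^{(T)}\circ\sigma\circ\cdots\circ\sigma\circ L^{(1)}$, where $h$ and $L^{(t)}:\mathbb{R}^{n^{k_{t-1}}\times d_{t-1}}\to\mathbb{R}^{n^{k_t}\times d_t}$ are linear layers equivariant under simultaneous permutations of node indices, with tensor orders $k_t\le2$, $k_0=2$; $\sigma$ is an activation function and $m$ a pointwise MLP. The coefficients of the equivariant layers in the standard basis of equivariant maps do not depend on $n$. Transformer: a composition of layers $X^{(l)}\mapsto X^{(l+1)}$ on $\mathbb{R}^{n\times d}$ (same parameters for every $n$), where, with heads $1\le h\le H$, $$A^{(l,h)}(X)=\mathrm{softmax}\Big(\tfrac{XW_Q^{(l,h)}(XW_K^{(l,h)})^T}{\sqrt{d_h}}\Big),\quad Y^{(l)}=X^{(l)}+\Big(\sum_{h=1}^H A^{(l,h)}(X^{(l)})X^{(l)}W_V^{(l,h)}\Big)W_O^{(l)},\quad X^{(l+1)}=Y^{(l)}+\sigma(Y^{(l)}W_1^{(l)})W_2^{(l)},$$ with $W_Q,W_K,W_V\in\mathbb{R}^{d\times d_h}$, $W_O\in\mathbb{R}^{d_h\times d}$, $W_1\in\mathbb{R}^{d\times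 d_r}$, $W_2\in\mathbb{R}^{d_r\times d}$, row-wise softmax, $\sigma$ an entrywise activation function (usually GELU). A $\phi$-APE-GT is a transformer applied to either $[X_G|\phi_G]$ (concatenation) or $X_G+\phi_G$ (when dimensions agree). A $\psi$-RPE-GT is a transformer applied to $X_G$ whose attention matrices are replaced by $A(X)=f_1(\psi_G)\odot\mathrm{softmax}\big(XW_Q(XW_K)^T/\sqrt{d_h}+f_2(\psi_G)\big)$ with $f_1,f_2:\mathbb{R}^k\to\mathbb{R}$ functions applied to each entry $\psi_G(u,v)$ (they may differ between layers and heads), $\odot$ the entrywise product. Two graphs are indistinguishable by a graph transformer if its outputs have the same multiset of node features (rows). *)

theory Defs
  imports "Jordan_Normal_Form.Matrix" "HOL-Library.Multiset" "HOL-Computational_Algebra.Polynomial"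
begin

section \<open>Graphs and positional encodings\<close>

text \<open>The vertex set of a graph with \<open>n\<close> vertices is \<open>{..<n}\<close>; all notions below are invariant
  under relabelling, so this fixes nothing but the row order of the matrices involved.\<close>

record graph =
  nverts :: nat
  edge :: "nat \<Rightarrow> nat \<Rightarrow> bool"

definition simple_graph :: "graph \<Rightarrow> bool" where
  "simple_graph G \<longleftrightarrow>
     (\<forall>u v. edge G u v \<longrightarrow> u < nverts G \<and> v < nverts G \<and> u \<noteq> v \<and> edge G v u)"

definition graph_iso :: "(nat \<Rightarrow> nat) \<Rightarrow> graph \<Rightarrow> graph \<Rightarrow> bool" where
  "graph_iso \<pi> G H \<longleftrightarrow> bij_betw \<pi> {..<nverts G} {..<nverts H} \<and>
     (\<forall>u<nverts G. \<forall>v<nverts G. edge G u v \<longleftrightarrow> edge H (\<pi> u) (\<pi> v))"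

text \<open>The map \<open>\<phi>\<^sub>G\<close> from the vertices of \<open>G\<close> to \<open>\<real>\<^sup>l\<close> is the matrix with rows \<open>\<phi>\<^sub>G(u)\<close>.\<close>

definition APE :: "nat \<Rightarrow> (graph \<Rightarrow> real mat) \<Rightarrow> bool" where
  "APE l \<phi> \<longleftrightarrow>
     (\<forall>G. simple_graph G \<longrightarrow> \<phi> G \<in> carrier_mat (nverts G) l) \<and>
     (\<forall>G H \<pi>. simple_graph G \<longrightarrow> simple_graph H \<longrightarrow> graph_iso \<pi> G H \<longrightarrow>
        (\<forall>u<nverts G. row (\<phi> G) u = row (\<phi> H) (\<pi> u)))"

definition vertex_degree :: "graph \<Rightarrow> nat \<Rightarrow> nat" where
  "vertex_degree G u = card {v. v < nverts G \<and> edge G u v}"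

definition degree_mat :: "graph \<Rightarrow> real mat" where
  "degree_mat G = mat_diag (nverts G) (\<lambda>u. real (vertex_degree G u))"

definition adj_mat :: "graph \<Rightarrow> real mat" where
  "adj_mat G = mat (nverts G) (nverts G) (\<lambda>(u, v). if edge G u v then 1 else 0)"

definition laplacian :: "graph \<Rightarrow> real mat" where
  "laplacian G = degree_mat G - adj_mat G"

text \<open>Moore--Penrose conditions.\<close>

definition is_pseudoinverse :: "real mat \<Rightarrow> real mat \<Rightarrow> bool" where
  "is_pseudoinverse M P \<longleftrightarrow> P \<in> carrier_mat (dim_col M) (dim_row M) \<and>
     M * P * M = M \<and> P * M * P = P \<and>
     transpose_mat (M * P) = M * P \<and> transpose_mat (P * M) = P * M"

definition pseudoinverse :: "real mat \<Rightarrow> real mat" where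
  "pseudoinverse M = (THE P. is_pseudoinverse M P)"

definition RD :: "graph \<Rightarrow> nat \<Rightarrow> nat \<Rightarrow> real" where
  "RD G u v = (let P = pseudoinverse (laplacian G) in P $$ (u, u) + P $$ (v, v) - 2 * P $$ (u, v))"

section \<open>Second order equivariant graph networks\<close>

text \<open>A tensor of order \<open>k\<close> on \<open>n\<close> nodes with \<open>d\<close> channels maps each multi-index in
  \<open>multi_indices n k\<close> to a vector in \<open>\<real>\<^sup>d\<close>; values at other lists are irrelevant.\<close>

type_synonym tensor = "nat list \<Rightarrow> real vec"

definition multi_indices :: "nat \<Rightarrow> nat \<Rightarrow> nat list set" where
  "multi_indices n k = {a. length a = k \<and> set a \<subseteq> {..<n}}"

text \<open>The orbit of a multi-index under simultaneous permutation of the node indices is determined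
  by which of its entries coincide. Hence the matrices indexed by (output index, input index)
  that are the indicators of one such equality pattern form the standard basis of the linear
  equivariant maps from order \<open>k\<close> to order \<open>k'\<close>. A layer stores, for each pattern, its coefficient
  (a matrix acting on the channels); the same coefficients are used for every \<open>n\<close>.\<close>

definition eq_pattern :: "nat list \<Rightarrow> (nat \<times> nat) set" where
  "eq_pattern c = {(p, q). p < length c \<and> q < length c \<and> c ! p = c ! q}"

record equiv_layer =
  ord_in :: nat
  dim_in :: nat
  ord_out :: nat
  dim_out :: nat
  coeff :: "(nat \<times> nat) set \<Rightarrow> real mat"

definition equiv_layer_wf :: "equiv_layer \<Rightarrow> bool" where
  "equiv_layer_wf L \<longleftrightarrow> ord_in L \<le> 2 \<and> ord_out L \<le> 2 \<and>
     (\<forall>\<gamma>. coeff L \<gamma> \<in> carrier_mat (dim_out L) (dim_in L))"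

definition apply_layer :: "equiv_layer \<Rightarrow> nat \<Rightarrow> tensor \<Rightarrow> tensor" where
  "apply_layer L n X = (\<lambda>b. vec (dim_out L) (\<lambda>j.
     \<Sum>a\<in>multi_indices n (ord_in L). (coeff L (eq_pattern (a @ b)) *\<^sub>v X a) $ j))"

fun apply_layers :: "(real \<Rightarrow> real) \<Rightarrow> nat \<Rightarrow> equiv_layer list \<Rightarrow> tensor \<Rightarrow> tensor" where
  "apply_layers act n [] X = X"
| "apply_layers act n [L] X = apply_layer L n X"
| "apply_layers act n (L # L' # Ls) X =
     apply_layers act n (L' # Ls) (\<lambda>a. map_vec act (apply_layer L n X a))"

text \<open>Multilayer perceptrons: affine maps \<open>x \<mapsto> W x + b\<close> with the activation between them.\<close>

type_synonym mlp = "(real mat \<times> real vec) list"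

fun mlp_wf :: "nat \<Rightarrow> mlp \<Rightarrow> nat \<Rightarrow> bool" where
  "mlp_wf d [] d' \<longleftrightarrow> d = d'"
| "mlp_wf d ((W, b) # M) d' \<longleftrightarrow>
     dim_col W = d \<and> dim_vec b = dim_row W \<and> mlp_wf (dim_row W) M d'"

fun apply_mlp :: "(real \<Rightarrow> real) \<Rightarrow> mlp \<Rightarrow> real vec \<Rightarrow> real vec" where
  "apply_mlp act [] x = x"
| "apply_mlp act [(W, b)] x = W *\<^sub>v x + b"
| "apply_mlp act ((W, b) # Wb # M) x = apply_mlp act (Wb # M) (map_vec act (W *\<^sub>v x + b))"

text \<open>\<open>egn_layers\<close> is \<open>[L\<^sup>(\<^sup>1\<^sup>), \<dots>, L\<^sup>(\<^sup>T\<^sup>)]\<close>, \<open>egn_mlp\<close> is \<open>m\<close>, and \<open>egn_head\<close> is \<open>h\<close>.\<close>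

record egn =
  egn_layers :: "equiv_layer list"
  egn_mlp :: mlp
  egn_head :: equiv_layer

definition egn_wf :: "nat \<Rightarrow> nat \<Rightarrow> egn \<Rightarrow> bool" where
  "egn_wf k l g \<longleftrightarrow> egn_layers g \<noteq> [] \<and>
     (\<forall>L\<in>set (egn_layers g). equiv_layer_wf L) \<and>
     ord_in (hd (egn_layers g)) = 2 \<and> dim_in (hd (egn_layers g)) = k \<and>
     successively (\<lambda>L L'. ord_in L' = ord_out L \<and> dim_in L' = dim_out L) (egn_layers g) \<and>
     mlp_wf (dim_out (last (egn_layers g))) (egn_mlp g) (dim_in (egn_head g)) \<and>
     equiv_layer_wf (egn_head g) \<and>
     ord_in (egn_head g) = ord_out (last (egn_layers g)) \<and>
     ord_out (egn_head g) = 1 \<and> dim_out (egn_head g) = l"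

definition apply_egn :: "(real \<Rightarrow> real) \<Rightarrow> egn \<Rightarrow> nat \<Rightarrow> tensor \<Rightarrow> real mat" where
  "apply_egn act g n X =
     (let Z = apply_layer (egn_head g) n
                (\<lambda>a. apply_mlp act (egn_mlp g) (apply_layers act n (egn_layers g) X a))
      in mat n (dim_out (egn_head g)) (\<lambda>(u, j). Z [u] $ j))"

definition stack :: "real mat \<Rightarrow> real mat \<Rightarrow> tensor" where
  "stack M N = (\<lambda>a. vec_of_list [M $$ (a ! 0, a ! 1), N $$ (a ! 0, a ! 1)])"

text \<open>The usual hypothesis on an activation function in universal approximation theorems. Some
  hypothesis is needed: with the identity as activation, a network is a linear map up to
  translation.\<close>

definition nonpolynomial_activation :: "(real \<Rightarrow> real) \<Rightarrow> bool" where
  "nonpolynomial_activation act \<longleftrightarrow> continuous_on UNIV act \<and> (\<nexists>p :: real poly. act = poly p)"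

section \<open>Diagonally augmented SPE\<close>

definition deepsets :: "(real vec \<Rightarrow> real vec) \<Rightarrow> bool" where
  "deepsets f \<longleftrightarrow>
     (\<exists>p (\<eta> :: real \<Rightarrow> real vec) (\<rho> :: real \<Rightarrow> real vec \<Rightarrow> real).
        (\<forall>x. \<eta> x \<in> carrier_vec p) \<and>
        (\<forall>\<Lambda>. f \<Lambda> = vec (dim_vec \<Lambda>)
           (\<lambda>i. \<rho> (\<Lambda> $ i) (vec p (\<lambda>q. \<Sum>j<dim_vec \<Lambda>. \<eta> (\<Lambda> $ j) $ q)))))"

definition diag_of_vec :: "real vec \<Rightarrow> real mat" where
  "diag_of_vec v = mat_diag (dim_vec v) (\<lambda>i. v $ i)"

definition eigendecomposition :: "real mat \<Rightarrow> real mat \<Rightarrow> real vec \<Rightarrow> bool" where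
  "eigendecomposition M V \<Lambda> \<longleftrightarrow>
     V \<in> carrier_mat (dim_row M) (dim_row M) \<and> \<Lambda> \<in> carrier_vec (dim_row M) \<and>
     transpose_mat V * V = 1\<^sub>m (dim_row M) \<and>
     (\<forall>i j. i \<le> j \<longrightarrow> j < dim_row M \<longrightarrow> \<Lambda> $ i \<le> \<Lambda> $ j) \<and>
     M = V * diag_of_vec \<Lambda> * transpose_mat V"

text \<open>For \<open>f\<close> of DeepSets type, \<open>V diag(f(\<Lambda>)) V\<^sup>T\<close> does not depend on the choice of the
  orthonormal eigenbasis, so it is harmless to require the equation for all choices.\<close>

definition diag_aug_SPE ::
    "(real \<Rightarrow> real) \<Rightarrow> (real vec \<Rightarrow> real vec) \<Rightarrow> nat \<Rightarrow> (graph \<Rightarrow> real mat) \<Rightarrow> bool" where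
  "diag_aug_SPE act f l \<phi> \<longleftrightarrow>
     (\<exists>g. egn_wf 2 l g \<and>
        (\<forall>G V \<Lambda>. simple_graph G \<longrightarrow> eigendecomposition (laplacian G) V \<Lambda> \<longrightarrow>
           \<phi> G = apply_egn act g (nverts G)
             (stack (1\<^sub>m (nverts G)) (V * diag_of_vec (f \<Lambda>) * transpose_mat V))))"

section \<open>Graph transformers\<close>

record head =
  WQ :: "real mat"
  WK :: "real mat"
  WV :: "real mat"

text \<open>\<open>params T t\<close> is used for \<open>t < nlayers T\<close>, and \<open>heads L h\<close> for \<open>h < nheads T\<close>.\<close>

record tlayer =
  heads :: "nat \<Rightarrow> head"
  WO :: "real mat"
  W1 :: "real mat"
  W2 :: "real mat"

record transformer =
  nlayers :: nat
  width :: nat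
  nheads :: nat
  head_dim :: nat
  hidden_dim :: nat
  params :: "nat \<Rightarrow> tlayer"

definition transformer_wf :: "transformer \<Rightarrow> bool" where
  "transformer_wf T \<longleftrightarrow>
     width T > 0 \<and> nheads T > 0 \<and> head_dim T > 0 \<and> hidden_dim T > 0 \<and>
     (\<forall>t<nlayers T.
        (\<forall>h<nheads T. WQ (heads (params T t) h) \<in> carrier_mat (width T) (head_dim T) \<and>
           WK (heads (params T t) h) \<in> carrier_mat (width T) (head_dim T) \<and>
           WV (heads (params T t) h) \<in> carrier_mat (width T) (head_dim T)) \<and>
        WO (params T t) \<in> carrier_mat (head_dim T) (width T) \<and>
        W1 (params T t) \<in> carrier_mat (width T) (hidden_dim T) \<and>
        W2 (params T t) \<in> carrier_mat (hidden_dim T) (width T))"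

definition softmax_rows :: "real mat \<Rightarrow> real mat" where
  "softmax_rows S = mat (dim_row S) (dim_col S)
     (\<lambda>(u, v). exp (S $$ (u, v)) / (\<Sum>w<dim_col S. exp (S $$ (u, w))))"

definition scores :: "nat \<Rightarrow> head \<Rightarrow> real mat \<Rightarrow> real mat" where
  "scores dh a X = (1 / sqrt (real dh)) \<cdot>\<^sub>m ((X * WQ a) * transpose_mat (X * WK a))"

text \<open>\<open>att t h\<close> turns the score matrix of head \<open>h\<close> in layer \<open>t\<close> into the attention matrix: it is
  the row-wise softmax for a plain transformer, and \<open>RPE_attention\<close> below for an RPE-GT.\<close>

definition transformer_layer ::
    "(real \<Rightarrow> real) \<Rightarrow> transformer \<Rightarrow> (nat \<Rightarrow> nat \<Rightarrow> real mat \<Rightarrow> real mat) \<Rightarrow> nat \<Rightarrow> real mat \<Rightarrow> real mat" where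
  "transformer_layer act T att t X =
     (let L = params T t;
          Z = foldr (+)
                (map (\<lambda>h. att t h (scores (head_dim T) (heads L h) X) * X * WV (heads L h))
                   [0..<nheads T])
                (0\<^sub>m (dim_row X) (head_dim T));
          Y = X + Z * WO L
      in Y + map_mat act (Y * W1 L) * W2 L)"

fun transformer_state ::
    "(real \<Rightarrow> real) \<Rightarrow> transformer \<Rightarrow> (nat \<Rightarrow> nat \<Rightarrow> real mat \<Rightarrow> real mat) \<Rightarrow> real mat \<Rightarrow> nat \<Rightarrow> real mat" where
  "transformer_state act T att X 0 = X"
| "transformer_state act T att X (Suc t) =
     transformer_layer act T att t (transformer_state act T att X t)"

definition run_transformer ::
    "(real \<Rightarrow> real) \<Rightarrow> transformer \<Rightarrow> (nat \<Rightarrow> nat \<Rightarrow> real mat \<Rightarrow> real mat) \<Rightarrow> real mat \<Rightarrow> real mat" where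
  "run_transformer act T att X = transformer_state act T att X (nlayers T)"

definition plain_attention :: "nat \<Rightarrow> nat \<Rightarrow> real mat \<Rightarrow> real mat" where
  "plain_attention t h S = softmax_rows S"

definition RPE_attention ::
    "(nat \<Rightarrow> nat \<Rightarrow> 'k) \<Rightarrow> (nat \<Rightarrow> nat \<Rightarrow> 'k \<Rightarrow> real) \<Rightarrow> (nat \<Rightarrow> nat \<Rightarrow> 'k \<Rightarrow> real) \<Rightarrow>
     nat \<Rightarrow> nat \<Rightarrow> real mat \<Rightarrow> real mat" where
  "RPE_attention \<psi> f1 f2 t h S =
     (let A = softmax_rows (S + mat (dim_row S) (dim_col S) (\<lambda>(u, v). f2 t h (\<psi> u v)))
      in mat (dim_row S) (dim_col S) (\<lambda>(u, v). f1 t h (\<psi> u v) * A $$ (u, v)))"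

definition same_rows :: "real mat \<Rightarrow> real mat \<Rightarrow> bool" where
  "same_rows X Y \<longleftrightarrow> mset (rows X) = mset (rows Y)"

definition const_features :: "graph \<Rightarrow> nat \<Rightarrow> real mat" where
  "const_features G d = mat (nverts G) d (\<lambda>_. 1)"

definition concat_cols :: "real mat \<Rightarrow> real mat \<Rightarrow> real mat" where
  "concat_cols M N = mat (dim_row M) (dim_col M + dim_col N)
     (\<lambda>(u, j). if j < dim_col M then M $$ (u, j) else N $$ (u, j - dim_col M))"

definition APE_GT_indistinguishable ::
    "(real \<Rightarrow> real) \<Rightarrow> nat \<Rightarrow> (graph \<Rightarrow> real mat) \<Rightarrow> graph \<Rightarrow> graph \<Rightarrow> bool" where
  "APE_GT_indistinguishable act l \<phi> G H \<longleftrightarrow>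
     (\<forall>T. transformer_wf T \<longrightarrow>
        (\<forall>d>0. width T = d + l \<longrightarrow>
           same_rows
             (run_transformer act T plain_attention (concat_cols (const_features G d) (\<phi> G)))
             (run_transformer act T plain_attention (concat_cols (const_features H d) (\<phi> H)))) \<and>
        (width T = l \<longrightarrow>
           same_rows
             (run_transformer act T plain_attention (const_features G l + \<phi> G))
             (run_transformer act T plain_attention (const_features H l + \<phi> H))))"

definition RPE_GT_indistinguishable ::
    "(real \<Rightarrow> real) \<Rightarrow> (graph \<Rightarrow> nat \<Rightarrow> nat \<Rightarrow> 'k) \<Rightarrow> graph \<Rightarrow> graph \<Rightarrow> bool" where
  "RPE_GT_indistinguishable act \<psi> G H \<longleftrightarrow>
     (\<forall>T f1 f2. transformer_wf T \<longrightarrow>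
        same_rows
          (run_transformer act T (RPE_attention (\<psi> G) f1 f2) (const_features G (width T)))
          (run_transformer act T (RPE_attention (\<psi> H) f1 f2) (const_features H (width T))))"

end

theory Submission
  imports Defs "Jordan_Normal_Form.Char_Poly"
begin

text \<open>For \<open>f(\<Lambda>)\<^sub>i = inverse \<lambda>\<^sub>i\<close>, with \<open>inverse 0 = 0\<close>, the matrix \<open>V diag(f(\<Lambda>)) V\<^sup>T\<close> is the
  pseudoinverse of the Laplacian, from whose entries the resistance distance is read off.

  A layer of an RPE-GT updates a vertex \<open>u\<close> by a function of its state and of the multiset of the
  pairs (resistance distance to \<open>w\<close>, state of \<open>w\<close>), so the states are coarser than colour
  refinement with the resistance distances as edge colours. A 2-EGN computes this refinement exactly on
  the two given graphs: for a continuous nonpolynomial activation, finitely many features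
  \<open>act (w \<bullet> z)\<close> of the pair colours \<open>z\<close> have sums that separate any finite collection of
  multisets. The bias that such features need comes from the diagonal augmentation, which provides
  a constant channel. Finally, the rows of the APE itself are the output of a transformer without
  layers.\<close>

section \<open>The pseudoinverse of a real symmetric matrix\<close>

text \<open>Only \<open>f\<close> is fixed in advance; \<open>g\<close> may depend on the two
  graphs, on the transformer and on \<open>f1\<close>, \<open>f2\<close>. As \<open>f1\<close>,
  \<open>f2\<close> and the transformer's activation are arbitrary functions, the RPE-GT is not
  approximated: it is enough that equal rows of the APE force equal rows of its output, a condition
  on finitely many vertices that exact separation can meet. Two obstacles shape the networks.
  Equivariant layers are linear, while the separation needs arguments \<open>b + s * t\<close> with
  a free offset \<open>b\<close>; hence every layer must hand on a nonzero constant channel. And a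
  sum over \<open>w\<close> of vertex states alone would lose which distance belongs to which state;
  hence colours are kept on pairs of vertices, each containing the distance and the states of both
  ends, and are summed only after the activation. The pseudoinverse is a definite description, so
  its existence must be known for every Laplacian before it can be transported along isomorphisms;
  this is done without an eigenbasis.\<close>

lemma is_pseudoinverse_unique:
  assumes M: "M \<in> carrier_mat m n" and P: "is_pseudoinverse M P" and Q: "is_pseudoinverse M Q"
  shows "P = Q"
proof -
  have c: "P \<in> carrier_mat n m" "Q \<in> carrier_mat n m"
    using M P Q by (auto simp: is_pseudoinverse_def)
  have p: "M * P * M = M" "P * M * P = P" "transpose_mat (M * P) = M * P"
      "transpose_mat (P * M) = P * M"
    and q: "M * Q * M = M" "Q * M * Q = Q" "transpose_mat (M * Q) = M * Q"
      "transpose_mat (Q * M) = Q * M"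
    using P Q by (auto simp: is_pseudoinverse_def)
  \<comment> \<open>Both \<open>M * P\<close> and \<open>M * Q\<close> are symmetric, so transposing
    their product swaps the factors, and the swapped product collapses to \<open>M * Q\<close>. The
    same works on the other side.\<close>
  have "M * P = (M * Q * M) * P" using q(1) by simp
  also have "\<dots> = (M * Q) * (M * P)" using M c by (simp add: assoc_mult_mat[of M m n "Q * M" n P m]
        assoc_mult_mat[of Q n m M n P m] assoc_mult_mat[of M m n Q m "M * P" m])
  also have "\<dots> = transpose_mat (M * Q) * transpose_mat (M * P)" using p q by simp
  also have "\<dots> = transpose_mat ((M * P) * (M * Q))"
    by (rule transpose_mult[symmetric, of _ m m _ m]) (use M c in auto)
  also have "(M * P) * (M * Q) = (M * P * M) * Q"
    using M c by (simp add: assoc_mult_mat[of M m n "P * M" n Q m]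
        assoc_mult_mat[of P n m M n Q m] assoc_mult_mat[of M m n P m "M * Q" m])
  also have "transpose_mat \<dots> = M * Q" using p(1) q(3) by simp
  finally have 1: "M * P = M * Q" .
  have "P * M = P * (M * Q * M)" using q(1) by simp
  also have "\<dots> = (P * M) * (Q * M)"
    using M c by (simp add: assoc_mult_mat[of M m n Q m M n] assoc_mult_mat[of P n m M n "Q * M" n])
  also have "\<dots> = transpose_mat (P * M) * transpose_mat (Q * M)" using p q by simp
  also have "\<dots> = transpose_mat ((Q * M) * (P * M))"
    by (rule transpose_mult[symmetric, of _ n n _ n]) (use M c in auto)
  also have "(Q * M) * (P * M) = Q * (M * P * M)"
    using M c by (simp add: assoc_mult_mat[of M m n P m M n] assoc_mult_mat[of Q n m M n "P * M" n])
  also have "transpose_mat \<dots> = Q * M" using p(1) q(4) by simp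
  finally have 2: "P * M = Q * M" .
  have "P = (P * M) * P" using p by simp
  also have "\<dots> = Q * (M * P)" using M c 2 by (simp add: assoc_mult_mat[of Q n m M n P m])
  also have "\<dots> = (Q * M) * Q" using M c 1 by (simp add: assoc_mult_mat[of Q n m M n Q m])
  finally show ?thesis using q by simp
qed

lemma pseudoinverse_eqI:
  assumes "is_pseudoinverse M P"
  shows "pseudoinverse M = P"
  unfolding pseudoinverse_def
  using assms is_pseudoinverse_unique[of M "dim_row M" "dim_col M"] by (intro the_equality) auto

text \<open>By symmetry, the transpose of \<open>N\<close> times \<open>M * (M * N)\<close> is the
  Gram matrix of the columns of \<open>M * N\<close>; its diagonal entries are sums of squares, so
  they vanish only if the columns do.\<close>

lemma symmetric_mult_cancel:
  fixes M N :: "real mat"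
  assumes M: "M \<in> carrier_mat n n" "transpose_mat M = M" and N: "N \<in> carrier_mat n k"
    and zero: "M * (M * N) = 0\<^sub>m n k"
  shows "M * N = 0\<^sub>m n k"
proof -
  have "transpose_mat (M * N) * (M * N) = transpose_mat N * (M * (M * N))"
    using M N by (simp add: transpose_mult[of _ n n _ k] assoc_mult_mat[of _ k n M n "M * N" k])
  then have z: "transpose_mat (M * N) * (M * N) = 0\<^sub>m k k" using zero N by simp
  show ?thesis
  proof (rule eq_matI)
    fix i j assume "i < dim_row (0\<^sub>m n k :: real mat)" "j < dim_col (0\<^sub>m n k :: real mat)"
    then have ij: "i < n" "j < k" by auto
    have "(\<Sum>l<n. ((M * N) $$ (l, j))\<^sup>2) = (transpose_mat (M * N) * (M * N)) $$ (j, j)"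
      using M N ij by (simp add: scalar_prod_def power2_eq_square lessThan_atLeast0)
    also have "\<dots> = 0" using z ij by simp
    finally have "((M * N) $$ (i, j))\<^sup>2 = 0"
      using ij by (subst (asm) sum_nonneg_eq_0_iff) auto
    then show "(M * N) $$ (i, j) = 0\<^sub>m n k $$ (i, j)" using ij by simp
  qed (use M N in auto)
qed

text \<open>Comparing coefficients in \<open>(x I - M) adj (x I - M) = \<chi>(x) I\<close>, where \<open>x ^ k\<close> is the lowest
  monomial of \<open>\<chi>\<close>: if \<open>B\<^sub>j\<close> are the coefficients of the adjugate, then
  \<open>B\<^sub>j = M B\<^sub>j\<^sub>+\<^sub>1\<close> for \<open>j + 1 < k\<close>, so that \<open>M ^ k B\<^sub>k\<^sub>-\<^sub>1 = 0\<close> and hence \<open>M B\<^sub>k\<^sub>-\<^sub>1 = 0\<close>.\<close>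

lemma symmetric_square_divides:
  fixes M :: "real mat"
  assumes M: "M \<in> carrier_mat n n" "transpose_mat M = M"
  shows "\<exists>Y\<in>carrier_mat n n. M * (M * Y) = M"
proof -
  define C where "C = char_poly_matrix M"
  define A where "A = Determinant.adj_mat C"
  define \<chi> where "\<chi> = det C"
  have C: "C \<in> carrier_mat n n" using M by (simp add: C_def)
  have A: "A \<in> carrier_mat n n" "C * A = \<chi> \<cdot>\<^sub>m 1\<^sub>m n"
    using Determinant.adj_mat[OF C] by (auto simp: A_def \<chi>_def)
  define B where "B j = mat n n (\<lambda>(r, c). poly.coeff (A $$ (r, c)) j)" for j
  have B: "B j \<in> carrier_mat n n" for j by (simp add: B_def)
  have B_entry: "B j $$ (r, c) = poly.coeff (A $$ (r, c)) j" if "r < n" "c < n" for r c j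
    using that by (simp add: B_def)
  have entry: "C $$ (r, l) = (if r = l then [:0, 1:] else 0) - [:M $$ (r, l):]"
    if "r < n" "l < n" for r l
    using that M by (simp add: C_def char_poly_matrix_def)
  have prod: "(if r = c then \<chi> else 0) = pCons 0 (A $$ (r, c)) - (\<Sum>l<n. smult (M $$ (r, l)) (A $$ (l, c)))"
    if "r < n" "c < n" for r c
  proof -
    have "(if r = c then \<chi> else 0) = (C * A) $$ (r, c)" using that A by simp
    also have "\<dots> = (\<Sum>l<n. C $$ (r, l) * A $$ (l, c))"
      using that A(1) C by (simp add: scalar_prod_def lessThan_atLeast0)
    also have "\<dots> = (\<Sum>l<n. (if r = l then pCons 0 (A $$ (l, c)) else 0) - smult (M $$ (r, l)) (A $$ (l, c)))"
      using that by (intro sum.cong) (auto simp: entry left_diff_distrib)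
    finally show ?thesis using that by (simp add: sum_subtractf)
  qed
  have MB: "(M * B j) $$ (r, c) = (\<Sum>l<n. M $$ (r, l) * poly.coeff (A $$ (l, c)) j)"
    if "r < n" "c < n" for r c j
    using that M by (simp add: B_def scalar_prod_def lessThan_atLeast0)
  have "\<chi> \<noteq> 0"
    using degree_monic_char_poly[OF M(1)] by (auto simp: \<chi>_def C_def char_poly_def)
  define k where "k = (LEAST j. poly.coeff \<chi> j \<noteq> 0)"
  have k: "poly.coeff \<chi> k \<noteq> 0"
    unfolding k_def using \<open>\<chi> \<noteq> 0\<close> leading_coeff_neq_0 by (rule_tac LeastI) blast
  have low: "poly.coeff \<chi> j = 0" if "j < k" for j
    using not_less_Least that unfolding k_def by blast
  have MB0: "M * B 0 = 0\<^sub>m n n" if "0 < k"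
  proof (rule eq_matI)
    fix r c assume "r < dim_row (0\<^sub>m n n :: real mat)" "c < dim_col (0\<^sub>m n n :: real mat)"
    then have rc: "r < n" "c < n" by auto
    show "(M * B 0) $$ (r, c) = 0\<^sub>m n n $$ (r, c)"
      using arg_cong[OF prod[OF rc], of "\<lambda>p. poly.coeff p 0"] low[OF that] rc
      by (auto simp: MB coeff_sum split: if_splits)
  qed (use M B in auto)
  have rec: "B j = M * B (Suc j)" if "Suc j < k" for j
  proof (rule eq_matI)
    fix r c assume "r < dim_row (M * B (Suc j))" "c < dim_col (M * B (Suc j))"
    then have rc: "r < n" "c < n" using M B[of "Suc j"] by auto
    show "B j $$ (r, c) = (M * B (Suc j)) $$ (r, c)"
      using arg_cong[OF prod[OF rc], of "\<lambda>p. poly.coeff p (Suc j)"] low[OF that] rc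
      by (auto simp: MB coeff_sum B_entry split: if_splits)
  qed (use M B[of j] B[of "Suc j"] in auto)
  have ann: "M * B j = 0\<^sub>m n n" if "j < k" for j
    using that
  proof (induction j)
    case (Suc j)
    then show ?case using rec[of j] symmetric_mult_cancel[OF M B] by simp
  qed (use MB0 in simp)
  \<comment> \<open>The coefficient of \<open>x ^ k\<close> gives \<open>M * B k\<close> as the
    preceding coefficient matrix minus a nonzero multiple of the identity; one more factor
    \<open>M\<close> kills the former. \<open>B'\<close> is that preceding matrix, read as zero for
    \<open>k = 0\<close>.\<close>
  have top: "M * (M * B k) = (- poly.coeff \<chi> k) \<cdot>\<^sub>m M"
  proof -
    define B' where "B' = (if k = 0 then 0\<^sub>m n n else B (k - 1))"
    have B': "B' \<in> carrier_mat n n" "M * B' = 0\<^sub>m n n"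
      using B ann[of "k - 1"] M by (auto simp: B'_def)
    have "M * B k = B' + (- poly.coeff \<chi> k) \<cdot>\<^sub>m 1\<^sub>m n"
    proof (rule eq_matI)
      fix r c assume "r < dim_row (B' + (- poly.coeff \<chi> k) \<cdot>\<^sub>m 1\<^sub>m n)"
        "c < dim_col (B' + (- poly.coeff \<chi> k) \<cdot>\<^sub>m 1\<^sub>m n)"
      then have rc: "r < n" "c < n" by auto
      show "(M * B k) $$ (r, c) = (B' + (- poly.coeff \<chi> k) \<cdot>\<^sub>m 1\<^sub>m n) $$ (r, c)"
        using arg_cong[OF prod[OF rc], of "\<lambda>p. poly.coeff p k"] rc
        by (cases k) (auto simp: MB coeff_sum B_entry B'_def split: if_splits)
    qed (use M B B' in auto)
    then have "M * (M * B k) = M * B' + M * ((- poly.coeff \<chi> k) \<cdot>\<^sub>m 1\<^sub>m n)"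
      using mult_add_distrib_mat[OF M(1) B'(1), of "(- poly.coeff \<chi> k) \<cdot>\<^sub>m 1\<^sub>m n"] by simp
    then show ?thesis using M B' by (simp add: mult_smult_distrib[of _ n n _ n])
  qed
  define Y where "Y = (- 1 / poly.coeff \<chi> k) \<cdot>\<^sub>m B k"
  have "M * (M * Y) = (- 1 / poly.coeff \<chi> k) \<cdot>\<^sub>m (M * (M * B k))"
    using M B by (simp add: Y_def mult_smult_distrib[of _ n n _ n])
  also have "\<dots> = M" using M k unfolding top by (intro eq_matI) auto
  finally show ?thesis using B by (intro bexI[of _ Y]) (auto simp: Y_def)
qed

text \<open>With \<open>M * (M * Y) = M\<close>, the matrix \<open>E = M * Y\<close> satisfies
  \<open>M * E = M\<close>, which makes it equal to its own Gram matrix: it is the orthogonal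
  projection onto the range of \<open>M\<close>. Then \<open>P = E * Y\<close> is symmetric with
  \<open>M * P = E\<close>, and transposing gives \<open>P * M = E\<close>.\<close>

lemma exists_pseudoinverse_symmetric:
  fixes M :: "real mat"
  assumes M: "M \<in> carrier_mat n n" "transpose_mat M = M"
  shows "\<exists>P. is_pseudoinverse M P"
proof -
  obtain Y where Y: "Y \<in> carrier_mat n n" "M * (M * Y) = M"
    using symmetric_square_divides[OF M] by blast
  note assoc = assoc_mult_mat[of _ n n _ n _ n]
  define E where "E = M * Y"
  have E: "E \<in> carrier_mat n n" using M Y by (simp add: E_def)
  have tE: "transpose_mat E = transpose_mat Y * M"
    using M Y by (simp add: E_def transpose_mult[of _ n n _ n])
  have ME: "M * E = M" using Y by (simp add: E_def)
  have "transpose_mat E * E = transpose_mat Y * (M * E)"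
    using M(1) Y(1) E by (simp add: tE assoc)
  then have EE: "transpose_mat E * E = transpose_mat E" by (simp add: ME tE)
  have "transpose_mat (transpose_mat E * E) = transpose_mat E * E"
    using E by (simp add: transpose_mult[of _ n n _ n])
  then have symE: "transpose_mat E = E" using EE by simp
  then have idem: "E * E = E" using EE by simp
  have EM: "E * M = M"
  proof -
    have "transpose_mat (M * E) = E * M" using M E symE by (simp add: transpose_mult[of _ n n _ n])
    then show ?thesis using ME M by simp
  qed
  define P where "P = E * Y"
  have P: "P \<in> carrier_mat n n" using E Y by (simp add: P_def)
  have MP: "M * P = E"
  proof -
    have "M * P = (M * E) * Y" using M(1) E Y(1) by (simp add: P_def assoc)
    then show ?thesis unfolding ME by (simp add: E_def)
  qed
  have "P = transpose_mat Y * (M * Y)"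
    using tE symE M(1) Y(1) by (simp add: P_def assoc)
  then have "transpose_mat P = P"
    using M Y by (simp add: transpose_mult[of _ n n _ n] assoc)
  then have PM: "P * M = E"
    using MP M P symE transpose_mult[of M n n P n] by simp
  have "E * P = P" using E Y(1) idem by (simp add: P_def assoc[symmetric])
  then show ?thesis
    using M P MP PM EM symE by (intro exI[of _ P]) (simp add: is_pseudoinverse_def)
qed

lemma is_pseudoinverse_pseudoinverse:
  assumes "M \<in> carrier_mat n n" "transpose_mat M = M"
  shows "is_pseudoinverse M (pseudoinverse M)"
  using exists_pseudoinverse_symmetric[OF assms] pseudoinverse_eqI by metis

text \<open>Conjugation by \<open>V\<close> respects products and transposes, so the four conditions
  reduce to diagonal matrices. There they hold entrywise, with \<open>inverse 0 = 0\<close> taking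
  care of the kernel.\<close>

lemma eigendecomposition_is_pseudoinverse:
  assumes "M \<in> carrier_mat n n" and e: "eigendecomposition M V \<Lambda>"
  shows "is_pseudoinverse M
    (V * diag_of_vec (vec (dim_vec \<Lambda>) (\<lambda>i. inverse (\<Lambda> $ i))) * transpose_mat V)"
proof -
  define T where "T = transpose_mat V"
  define D where "D = diag_of_vec \<Lambda>"
  define D' where "D' = diag_of_vec (vec (dim_vec \<Lambda>) (\<lambda>i. inverse (\<Lambda> $ i)))"
  have V: "V \<in> carrier_mat n n" "T \<in> carrier_mat n n" "dim_vec \<Lambda> = n" "T * V = 1\<^sub>m n"
      "M = V * D * T"
    using assms by (auto simp: eigendecomposition_def T_def D_def)
  have D: "D \<in> carrier_mat n n" "D' \<in> carrier_mat n n"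
    using V by (auto simp: D_def D'_def diag_of_vec_def)
  note assoc = assoc_mult_mat[of _ n n _ n _ n]
  have comp: "(V * X * T) * (V * Z * T) = V * (X * Z) * T"
    if "X \<in> carrier_mat n n" "Z \<in> carrier_mat n n" for X Z
  proof -
    have "(V * X * T) * (V * Z * T) = V * X * ((T * V) * (Z * T))"
      using V(1,2) that by (simp add: assoc)
    then show ?thesis using V that by (simp add: assoc)
  qed
  have tr: "transpose_mat (V * X * T) = V * transpose_mat X * T" if "X \<in> carrier_mat n n" for X
    using V that by (simp add: T_def transpose_mult[of _ n n _ n] assoc)
  have carV: "V * X * T \<in> carrier_mat n n" for X
    using V(1,2) by (intro carrier_matI) simp_all
  have Dm: "D = mat_diag n (\<lambda>i. \<Lambda> $ i)" "D' = mat_diag n (\<lambda>i. inverse (\<Lambda> $ i))"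
    using V(3) by (auto simp: D_def D'_def diag_of_vec_def mat_diag_def)
  have inv: "x * inverse x * x = x" "inverse x * x * inverse x = inverse x" for x :: real
    by (cases "x = 0"; simp)+
  have DD: "D * D' * D = D" "D' * D * D' = D'" "transpose_mat (D * D') = D * D'"
    "transpose_mat (D' * D) = D' * D"
    unfolding Dm by (simp_all add: inv) (auto simp: mat_diag_def)
  show ?thesis
    unfolding is_pseudoinverse_def D'_def[symmetric] T_def[symmetric]
    using carV D DD carrier_matD[OF V(1)] carrier_matD[OF V(2)]
    by (simp add: V(5) comp tr del: assoc_mult_mat)
qed

section \<open>Separating multisets with a nonpolynomial activation\<close>

definition fdiff :: "real \<Rightarrow> (real \<Rightarrow> real) \<Rightarrow> real \<Rightarrow> real" where
  "fdiff h f = (\<lambda>x. f (x + h) - f x)"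

lemma fdiff_pow_diff:
  "(fdiff h ^^ k) (\<lambda>x. f x - g x) = (\<lambda>x. (fdiff h ^^ k) f x - (fdiff h ^^ k) g x)"
  by (induction k) (auto simp: fdiff_def)

lemma fdiff_pow_cmult: "(fdiff h ^^ k) (\<lambda>x. c * f x) = (\<lambda>x. c * (fdiff h ^^ k) f x)"
  by (induction k) (auto simp: fdiff_def algebra_simps)

lemma fdiff_pow_zero: "(fdiff h ^^ k) (\<lambda>_. 0) = (\<lambda>_. 0)"
  by (induction k) (auto simp: fdiff_def)

text \<open>The iterated difference combines the values at \<open>x\<close>, ...,
  \<open>x + k * h\<close>, with coefficient 1 at the last one. A vanishing difference thus
  propagates \<open>k\<close> consecutive zeros to the next grid point.\<close>

lemma fdiff_pow_eq_last:
  assumes "\<And>i. i < k \<Longrightarrow> f (x + real i * h) = 0"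
  shows "(fdiff h ^^ k) f x = f (x + real k * h)"
  using assms
proof (induction k arbitrary: x)
  case (Suc k)
  have "(fdiff h ^^ k) f (x + h) = f ((x + h) + real k * h)"
  proof (rule Suc.IH)
    fix i assume "i < k"
    then show "f (x + h + real i * h) = 0"
      using Suc.prems[of "Suc i"] by (simp add: algebra_simps)
  qed
  moreover have "(fdiff h ^^ k) f x = 0"
    using Suc.IH[of x] Suc.prems by auto
  moreover have "(fdiff h ^^ Suc k) f x = (fdiff h ^^ k) f (x + h) - (fdiff h ^^ k) f x"
    by (simp add: fdiff_def)
  ultimately show ?case by (simp add: algebra_simps)
qed simp

text \<open>Each difference lowers the degree, since \<open>p(x + h)\<close> and \<open>p(x)\<close>
  have the same leading coefficient.\<close>

lemma fdiff_pow_poly: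
  assumes "degree p < k"
  shows "(fdiff h ^^ k) (poly p) = (\<lambda>_. 0)"
  using assms
proof (induction k arbitrary: p)
  case (Suc k)
  define q where "q = pcompose p [:h, 1:] - p"
  have q: "fdiff h (poly p) = poly q"
    by (auto simp: fdiff_def q_def poly_pcompose algebra_simps)
  have "degree q \<le> degree p"
    unfolding q_def by (rule degree_diff_le) (auto simp: degree_pcompose)
  moreover have "poly.coeff q (degree p) = 0"
    using lead_coeff_comp[of "[:h, 1:]" p] by (simp add: q_def degree_pcompose)
  ultimately have "q = 0 \<or> degree q < k"
    using Suc.prems eq_zero_or_degree_less[of q "degree p"] by auto
  then have "(fdiff h ^^ k) (poly q) = (\<lambda>_. 0)"
    using Suc.IH[of q] fdiff_pow_zero[where h=h and k=k] by (auto simp: poly_0[abs_def])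
  then show ?case by (simp add: funpow_Suc_right q del: funpow.simps)
qed simp

text \<open>Newton's scheme: a multiple of the product \<open>r\<close> of the linear factors
  corrects the value at the new node and leaves the old ones alone. The alternative
  \<open>p = 0\<close> covers the empty set, where no degree is below the cardinality.\<close>

lemma exists_interpolating_poly:
  fixes y :: "'a::field \<Rightarrow> 'a"
  assumes "finite S"
  shows "\<exists>p. (p = 0 \<or> degree p < card S) \<and> (\<forall>x\<in>S. poly p x = y x)"
  using assms
proof (induction S rule: finite_induct)
  case (insert a S)
  then obtain p where p: "p = 0 \<or> degree p < card S" "\<forall>x\<in>S. poly p x = y x" by auto
  define r where "r = (\<Prod>x\<in>S. [:- x, 1:])"
  have r: "poly r x = 0 \<longleftrightarrow> x \<in> S" for x
    using insert by (auto simp: r_def poly_prod)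
  have dr: "degree r = card S"
    unfolding r_def by (subst degree_prod_eq_sum_degree) auto
  define c where "c = (y a - poly p a) / poly r a"
  have "degree (p + smult c r) \<le> card S"
    using p(1) dr by (intro degree_add_le) (auto intro: order.trans[OF degree_smult_le])
  moreover have "poly (p + smult c r) x = y x" if "x \<in> insert a S" for x
    using that r p(2) insert.hyps by (auto simp: c_def)
  ultimately show ?case using insert.hyps
    by (intro exI[of _ "p + smult c r"]) auto
qed (auto intro: exI[of _ 0])

text \<open>This is Frechet's characterisation of polynomials. After subtracting the interpolant at
  \<open>k\<close> integers, the remainder \<open>g\<close> vanishes on every rational grid, hence
  on the rationals, hence everywhere by continuity.\<close>

lemma continuous_fdiff_pow_zero_imp_poly:
  fixes f :: "real \<Rightarrow> real" and k :: nat
  assumes cont: "continuous_on UNIV f" and zero: "\<And>h. (fdiff h ^^ k) f = (\<lambda>_. 0)"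
  shows "\<exists>p. f = poly p"
proof (cases "k = 0")
  case True
  then have "f = poly 0" using zero[of 0] by auto
  then show ?thesis by blast
next
  case False
  have inj: "inj_on real {..<k}" by auto
  obtain p where p: "p = 0 \<or> degree p < k" "\<forall>i<k. poly p (real i) = f (real i)"
    using exists_interpolating_poly[of "real ` {..<k}" f] inj by (auto simp: card_image)
  define g where "g x = f x - poly p x" for x
  have dp: "degree p < k" using p(1) False by auto
  have g0: "(fdiff h ^^ k) g x = 0" for h x
    unfolding g_def[abs_def] using fdiff_pow_diff[where h=h and k=k and f=f and g="poly p"] zero[of h] fdiff_pow_poly[OF dp, where h=h]
    by auto
  text \<open>On a grid of mesh \<open>1/N\<close> the function \<open>g\<close> is a polynomial of degree below \<open>k\<close>
    in the grid index, and it vanishes at the \<open>k\<close> integers \<open>0, \<dots>, k - 1\<close>.\<close>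
  have grid: "g (real j / real N - real M) = 0" if "N > 0" for j N M :: nat
  proof -
    define x0 where "x0 = - real M"
    define h where "h = 1 / real N"
    obtain q where q: "q = 0 \<or> degree q < k" "\<forall>i<k. poly q (real i) = g (x0 + real i * h)"
      using exists_interpolating_poly[of "real ` {..<k}" "\<lambda>x. g (x0 + x * h)"] inj
      by (auto simp: card_image)
    have dq: "degree q < k" using q(1) False by auto
    define u where "u x = g (x0 + x * h) - poly q x" for x
    have shift: "(fdiff 1 ^^ m) (\<lambda>x. g (x0 + x * h)) y = (fdiff h ^^ m) g (x0 + y * h)" for m y
      by (induction m arbitrary: y) (auto simp: fdiff_def algebra_simps)
    have u0: "(fdiff 1 ^^ k) u x = 0" for x
      unfolding u_def[abs_def] using fdiff_pow_diff[where h=1 and k=k and f="\<lambda>x. g (x0 + x * h)" and g="poly q"] shift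
        fdiff_pow_poly[OF dq, where h=1] g0 by auto
    \<comment> \<open>\<open>q\<close> interpolates \<open>g\<close> at the first \<open>k\<close>
      grid indices; the vanishing difference of \<open>u\<close> extends the agreement to all later
      ones.\<close>
    have uz: "u (real i) = 0" for i
    proof (induction i rule: less_induct)
      case (less i)
      show ?case
      proof (cases "i < k")
        case True then show ?thesis using q(2) by (simp add: u_def)
      next
        case False
        have "(fdiff 1 ^^ k) u (real (i - k)) = u (real (i - k) + real k * 1)"
        proof (rule fdiff_pow_eq_last)
          fix l assume "l < k"
          then have "u (real (i - k + l)) = 0" using False by (intro less.IH) auto
          then show "u (real (i - k) + real l * 1) = 0" by simp
        qed
        then show ?thesis using u0 False by simp
      qed
    qed
    \<comment> \<open>The grid starts at \<open>- M\<close>, so the integer \<open>i\<close> has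
      grid index \<open>(M + i) * N\<close>. This yields \<open>k\<close> distinct roots of
      \<open>q\<close>, more than its degree allows unless \<open>q = 0\<close>.\<close>
    have "poly q (real ((M + i) * N)) = 0" if "i < k" for i
    proof -
      have "x0 + real ((M + i) * N) * h = real i"
        using \<open>N > 0\<close> by (simp add: x0_def h_def)
      then have "g (x0 + real ((M + i) * N) * h) = 0"
        using p(2) that by (simp add: g_def)
      then show ?thesis using uz[of "(M + i) * N"] by (simp add: u_def)
    qed
    then have sub: "(\<lambda>i. real ((M + i) * N)) ` {..<k} \<subseteq> {x. poly q x = 0}" by auto
    have "q = 0"
    proof (rule ccontr)
      assume "q \<noteq> 0"
      have "inj_on (\<lambda>i. real ((M + i) * N)) {..<k}"
        using \<open>N > 0\<close> by (auto simp: inj_on_def)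
      then have "k \<le> card {x. poly q x = 0}"
        using card_mono[OF poly_roots_finite[OF \<open>q \<noteq> 0\<close>] sub] by (simp add: card_image)
      also have "\<dots> \<le> degree q" by (rule card_poly_roots_bound[OF \<open>q \<noteq> 0\<close>])
      finally show False using dq by simp
    qed
    then show ?thesis using uz[of j] by (simp add: u_def x0_def h_def algebra_simps)
  qed
  have rat: "g x = 0" if "x \<in> \<rat>" for x
  proof -
    obtain a b :: int where ab: "b > 0" "x = of_int a / of_int b"
      using Rats_cases'[OF \<open>x \<in> \<rat>\<close>] by blast
    \<comment> \<open>The grid is started far enough to the left for the index of \<open>x\<close>
      to be a natural number.\<close>
    define M where "M = nat \<bar>a\<bar>"
    have "a + int M * b \<ge> 0"
    proof -
      have "\<bar>a\<bar> \<le> \<bar>a\<bar> * b" using ab(1) by (simp add: mult_le_cancel_left1)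
      then show ?thesis by (simp add: M_def)
    qed
    then obtain j where j: "a + int M * b = int j" using nonneg_int_cases by blast
    have "x = real j / real (nat b) - real M"
    proof -
      have "of_int (a + int M * b) = (of_int (int j) :: real)" using j by simp
      then show ?thesis using ab by (simp add: field_simps)
    qed
    then show ?thesis using grid[of "nat b" j M] ab(1) by simp
  qed
  have contg: "continuous_on UNIV g" unfolding g_def by (intro continuous_intros cont)
  have "g x = 0" for x
  proof (rule ccontr)
    assume "g x \<noteq> 0"
    have "isCont g x" using contg by (simp add: continuous_on_eq_continuous_at)
    then have "\<forall>\<^sub>F y in at x. g y \<noteq> 0"
      using \<open>g x \<noteq> 0\<close> tendsto_imp_eventually_ne by (auto simp: isCont_def)
    then obtain d where d: "d > 0" "\<And>y. y \<noteq> x \<Longrightarrow> dist y x < d \<Longrightarrow> g y \<noteq> 0"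
      by (auto simp: eventually_at)
    obtain r where "r \<in> \<rat>" "x < r" "r < x + d"
      using Rats_dense_in_real[of x "x + d"] d(1) by auto
    then show False using d(2)[of r] rat[of r] by (auto simp: dist_real_def)
  qed
  then have "f = poly p" by (auto simp: g_def)
  then show ?thesis by blast
qed

text \<open>Replacing \<open>(b, s)\<close> by \<open>(b - d * t\<^sub>m, s + d)\<close> leaves the term of \<open>t\<^sub>m\<close> unchanged, so
  subtracting the two identities removes it at the cost of one difference.\<close>

lemma sum_dilations_zero_imp_fdiff_zero:
  fixes F :: "real \<Rightarrow> real \<Rightarrow> real"
  assumes "finite I" "t0 \<in> I" "\<And>b s. (\<Sum>t\<in>I. F t (b + s * t)) = 0"
  shows "(fdiff h ^^ (card I - 1)) (F t0) = (\<lambda>_. 0)"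
  using assms
proof (induction "card I" arbitrary: I F)
  case (Suc n)
  show ?case
  proof (cases "I = {t0}")
    case True
    have "F t0 x = 0" for x using Suc.prems(3)[of x 0] True by simp
    then show ?thesis using True by auto
  next
    case False
    then obtain tm where tm: "tm \<in> I" "tm \<noteq> t0" using Suc.prems(2) by auto
    define J where "J = I - {tm}"
    have J: "finite J" "t0 \<in> J" "card J = n" "I = insert tm J" "tm \<notin> J"
      using Suc.prems Suc.hyps(2) tm by (auto simp: J_def)
    \<comment> \<open>With this \<open>d\<close>, the shift \<open>d * (t - tm)\<close> is exactly
      \<open>h\<close> at \<open>t = t0\<close>.\<close>
    define d where "d = h / (t0 - tm)"
    define F' where "F' t x = F t (x + d * (t - tm)) - F t x" for t x
    have "(\<Sum>t\<in>J. F' t (b + s * t)) = 0" for b s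
    proof -
      have "(\<Sum>t\<in>I. F t ((b - d * tm) + (s + d) * t)) - (\<Sum>t\<in>I. F t (b + s * t)) = 0"
        using Suc.prems(3) by simp
      then show ?thesis using J(1,4,5)
        by (simp add: F'_def sum_subtractf algebra_simps)
    qed
    then have "(fdiff h ^^ (card J - 1)) (F' t0) = (\<lambda>_. 0)"
      by (intro Suc.hyps(1)) (use J in auto)
    moreover have "F' t0 = fdiff h (F t0)"
      using tm by (auto simp: F'_def fdiff_def d_def)
    moreover have "card I - 1 = Suc (card J - 1)"
      using J by (metis Suc.hyps(2) card_gt_0_iff diff_Suc_1 empty_iff Suc_pred)
    ultimately show ?thesis by (simp add: funpow_Suc_right del: funpow.simps)
  qed
qed simp

section \<open>Multisets of vectors told apart by sums of activations\<close>

lemma sum_mset_eq_sum_count: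
  fixes f :: "'a \<Rightarrow> real"
  assumes "finite S" "set_mset Q \<subseteq> S"
  shows "(\<Sum>z\<in>#Q. f z) = (\<Sum>z\<in>S. real (count Q z) * f z)"
  using assms(2)
proof (induction Q)
  case (add x Q)
  have "(\<Sum>z\<in>S. real (count (add_mset x Q) z) * f z) =
      (\<Sum>z\<in>S. real (count Q z) * f z + (if x = z then f z else 0))"
    by (intro sum.cong) (auto simp: algebra_simps)
  also have "\<dots> = (\<Sum>z\<in>#Q. f z) + f x"
    using add assms(1) by (simp add: sum.distrib)
  finally show ?case by simp
qed simp

text \<open>Project the finitely many vectors injectively to the line by \<open>\<tau>\<close>. If
  the multiplicities differed, \<open>c\<close> would give a nontrivial relation among the functions
  \<open>act (b + s * \<tau> z)\<close> for all \<open>b\<close>, \<open>s\<close>; eliminating all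
  terms but one makes the differences of \<open>act\<close> of a fixed order vanish for every step,
  so \<open>act\<close> would be a polynomial.\<close>

lemma mset_eq_if_activation_sums_eq:
  fixes M N :: "real vec multiset"
  assumes act: "nonpolynomial_activation act"
    and car: "\<And>z. z \<in># M + N \<Longrightarrow> z \<in> carrier_vec m"
    and cst: "k < m" "\<kappa> \<noteq> 0" "\<And>z. z \<in># M + N \<Longrightarrow> z $ k = \<kappa>"
    and eq: "\<And>w. w \<in> carrier_vec m \<Longrightarrow>
               (\<Sum>z\<in>#M. act (w \<bullet> z)) = (\<Sum>z\<in>#N. act (w \<bullet> z))"
  shows "M = N"
proof (rule ccontr)
  assume "M \<noteq> N"
  define S where "S = set_mset (M + N)"
  have finS: "finite S" by (simp add: S_def)
  define c where "c z = real (count M z) - real (count N z)" for z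
  obtain z0 where z0: "c z0 \<noteq> 0" using \<open>M \<noteq> N\<close> by (auto simp: c_def multiset_eq_iff)
  have "z0 \<in> S"
  proof (rule ccontr)
    assume "z0 \<notin> S"
    then have "count M z0 = 0" "count N z0 = 0" by (auto simp: S_def count_eq_zero_iff)
    then show False using z0 by (simp add: c_def)
  qed
  define P where "P z = (\<Sum>j<m. monom (z $ j) j)" for z :: "real vec"
  have coeffP: "poly.coeff (P z) j = z $ j" if "j < m" for z j
    using that by (simp add: P_def coeff_sum)
  have injP: "P z \<noteq> P z'" if "z \<in> S" "z' \<in> S" "z \<noteq> z'" for z z'
  proof
    assume "P z = P z'"
    then have "z $ j = z' $ j" if "j < m" for j using coeffP[OF that] by metis
    moreover have "dim_vec z = m" "dim_vec z' = m" using car that(1,2) by (auto simp: S_def)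
    ultimately have "z = z'" by (intro eq_vecI) auto
    then show False using that(3) by simp
  qed
  \<comment> \<open>The projection is evaluation at \<open>x\<close> of the polynomial whose
    coefficients are the entries of \<open>z\<close>. Two distinct vectors collide only at roots of
    a nonzero polynomial, so all but finitely many \<open>x\<close> are injective on
    \<open>S\<close>.\<close>
  define B where "B = (\<Union>(z, z')\<in>{(z, z'). z \<in> S \<and> z' \<in> S \<and> z \<noteq> z'}. {x. poly (P z - P z') x = 0})"
  have "finite {(z, z'). z \<in> S \<and> z' \<in> S \<and> z \<noteq> z'}"
    by (rule finite_subset[of _ "S \<times> S"]) (use finS in auto)
  moreover have "finite {x. poly (P z - P z') x = 0}" if "z \<in> S" "z' \<in> S" "z \<noteq> z'" for z z'
    using injP[OF that] by (intro poly_roots_finite) simp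
  ultimately have "finite B" unfolding B_def
    by (intro finite_UN_I) auto
  then obtain x where x: "x \<notin> B" using ex_new_if_finite infinite_UNIV_char_0 by blast
  define \<tau> where "\<tau> z = poly (P z) x" for z
  have inj\<tau>: "inj_on \<tau> S" using x by (fastforce simp: inj_on_def \<tau>_def B_def)
  have key: "(\<Sum>z\<in>S. c z * act (b + s * \<tau> z)) = 0" for b s
  proof -
    \<comment> \<open>The powers of \<open>x\<close> produce \<open>s * \<tau> z\<close>; the extra
      weight on the constant coordinate \<open>k\<close> produces the offset
      \<open>b\<close>.\<close>
    define w where "w = vec m (\<lambda>j. s * x ^ j + (if j = k then b / \<kappa> else 0))"
    have w: "w \<in> carrier_vec m" by (simp add: w_def)
    have wz: "w \<bullet> z = b + s * \<tau> z" if "z \<in> S" for z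
    proof -
      have z: "dim_vec z = m" "z $ k = \<kappa>" using car cst(3) that by (auto simp: S_def)
      have "w \<bullet> z = (\<Sum>j<m. s * (x ^ j * z $ j) + (if j = k then b / \<kappa> * z $ j else 0))"
        unfolding scalar_prod_def z(1) lessThan_atLeast0
        by (intro sum.cong) (auto simp: w_def algebra_simps)
      also have "\<dots> = s * (\<Sum>j<m. x ^ j * z $ j) + b"
        using cst(1,2) z(2) by (simp add: sum.distrib sum_distrib_left)
      also have "(\<Sum>j<m. x ^ j * z $ j) = \<tau> z"
        by (simp add: \<tau>_def P_def poly_sum poly_monom mult.commute)
      finally show ?thesis by simp
    qed
    have sm: "(\<Sum>z\<in>#Q. act (w \<bullet> z)) = (\<Sum>z\<in>S. real (count Q z) * act (b + s * \<tau> z))"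
      if "set_mset Q \<subseteq> S" for Q
    proof -
      have "(\<Sum>z\<in>#Q. act (w \<bullet> z)) = (\<Sum>z\<in>S. real (count Q z) * act (w \<bullet> z))"
        by (rule sum_mset_eq_sum_count[OF finS that])
      also have "\<dots> = (\<Sum>z\<in>S. real (count Q z) * act (b + s * \<tau> z))"
        using wz by (intro sum.cong) auto
      finally show ?thesis .
    qed
    show ?thesis using eq[OF w] sm[of M] sm[of N]
      by (simp add: S_def c_def left_diff_distrib sum_subtractf)
  qed
  define F where "F t = (\<lambda>y. c (the_inv_into S \<tau> t) * act y)" for t
  have "(\<Sum>t\<in>\<tau> ` S. F t (b + s * t)) = 0" for b s
    using key by (simp add: sum.reindex[OF inj\<tau>] F_def the_inv_into_f_f[OF inj\<tau>])
  then have "(fdiff h ^^ (card (\<tau> ` S) - 1)) (F (\<tau> z0)) = (\<lambda>_. 0)" for h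
    using \<open>z0 \<in> S\<close> finS by (intro sum_dilations_zero_imp_fdiff_zero) auto
  then have "(fdiff h ^^ (card (\<tau> ` S) - 1)) act = (\<lambda>_. 0)" for h
    using z0 \<open>z0 \<in> S\<close> by (auto simp: F_def fdiff_pow_cmult the_inv_into_f_f[OF inj\<tau>] fun_eq_iff)
  then have "\<exists>p. act = poly p"
    using act by (intro continuous_fdiff_pow_zero_imp_poly) (auto simp: nonpolynomial_activation_def)
  then show False using act by (auto simp: nonpolynomial_activation_def)
qed

section \<open>Equivariance of networks\<close>

lemma bij_betw_map_multi_indices:
  assumes "bij_betw \<pi> {..<n} {..<m}"
  shows "bij_betw (map \<pi>) (multi_indices n k) (multi_indices m k)"
  unfolding bij_betw_def
proof
  have inj: "inj_on \<pi> {..<n}" and im: "\<pi> ` {..<n} = {..<m}"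
    using assms by (auto simp: bij_betw_def)
  show "inj_on (map \<pi>) (multi_indices n k)"
    by (rule inj_onI, erule map_inj_on)
      (auto simp: multi_indices_def intro: inj_on_subset[OF inj])
  show "map \<pi> ` multi_indices n k = multi_indices m k"
  proof (intro subset_antisym subsetI)
    fix b assume "b \<in> map \<pi> ` multi_indices n k"
    then show "b \<in> multi_indices m k" using im by (fastforce simp: multi_indices_def)
  next
    fix b assume b: "b \<in> multi_indices m k"
    then have "b \<in> lists (\<pi> ` {..<n})" using im by (auto simp: multi_indices_def)
    then obtain a where "a \<in> lists {..<n}" "b = map \<pi> a" unfolding lists_image by auto
    then show "b \<in> map \<pi> ` multi_indices n k"
      using b by (auto simp: multi_indices_def lists_eq_set)
  qed
qed

lemma eq_pattern_map:
  assumes "inj_on \<pi> (set c)"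
  shows "eq_pattern (map \<pi> c) = eq_pattern c"
proof -
  have "\<pi> (c ! p) = \<pi> (c ! q) \<longleftrightarrow> c ! p = c ! q" if "p < length c" "q < length c" for p q
    using inj_on_eq_iff[OF assms, of "c ! p" "c ! q"] that by simp
  then show ?thesis unfolding eq_pattern_def by auto
qed

text \<open>The coefficients see only equality patterns, which an injective relabelling preserves;
  the rest is reindexing the sum.\<close>

lemma apply_layer_equivariant:
  assumes \<pi>: "bij_betw \<pi> {..<n} {..<m}"
    and X: "\<And>a. a \<in> multi_indices n (ord_in L) \<Longrightarrow> X a = X' (map \<pi> a)"
    and b: "set b \<subseteq> {..<n}"
  shows "apply_layer L n X b = apply_layer L m X' (map \<pi> b)"
proof -
  have pat: "eq_pattern (map \<pi> a @ map \<pi> b) = eq_pattern (a @ b)"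
    if "a \<in> multi_indices n (ord_in L)" for a
    unfolding map_append[symmetric]
    by (rule eq_pattern_map, rule inj_on_subset[OF bij_betw_imp_inj_on[OF \<pi>]])
      (use that b in \<open>auto simp: multi_indices_def\<close>)
  show ?thesis
    unfolding apply_layer_def
    by (intro arg_cong[where f="vec (dim_out L)"] ext,
        subst sum.reindex_bij_betw[OF bij_betw_map_multi_indices[OF \<pi>], symmetric])
      (auto intro!: sum.cong simp: pat X)
qed

lemma apply_layers_equivariant:
  assumes \<pi>: "bij_betw \<pi> {..<n} {..<m}"
    and X: "\<And>a. set a \<subseteq> {..<n} \<Longrightarrow> length a = k \<Longrightarrow> X a = X' (map \<pi> a)"
    and Ls: "Ls \<noteq> []" "ord_in (hd Ls) = k"
      "successively (\<lambda>L L'. ord_in L' = ord_out L \<and> dim_in L' = dim_out L) Ls"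
    and b: "set b \<subseteq> {..<n}"
  shows "apply_layers act n Ls X b = apply_layers act m Ls X' (map \<pi> b)"
  using X Ls
proof (induction Ls arbitrary: X X' k)
  case (Cons L Ls)
  have L: "apply_layer L n X c = apply_layer L m X' (map \<pi> c)" if "set c \<subseteq> {..<n}" for c
    using Cons.prems that
    by (intro apply_layer_equivariant[OF \<pi>]) (auto simp: multi_indices_def)
  show ?case
  proof (cases Ls)
    case Nil
    then show ?thesis using L b by simp
  next
    case (Cons L' Ls')
    have "apply_layers act n Ls (\<lambda>a. map_vec act (apply_layer L n X a)) b =
        apply_layers act m Ls (\<lambda>a. map_vec act (apply_layer L m X' a)) (map \<pi> b)"
      by (rule Cons.IH[where k="ord_in L'"]) (use L Cons Cons.prems in auto)
    then show ?thesis using Cons by simp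
  qed
qed simp

lemma row_apply_egn:
  assumes "u < n"
  shows "row (apply_egn act g n X) u =
    vec (dim_out (egn_head g)) (\<lambda>j. apply_layer (egn_head g) n
      (\<lambda>a. apply_mlp act (egn_mlp g) (apply_layers act n (egn_layers g) X a)) [u] $ j)"
  using assms by (auto simp: apply_egn_def Let_def)

text \<open>Serves the APE condition: an isomorphism that matches the input tensors matches the
  output rows.\<close>

lemma apply_egn_equivariant:
  assumes g: "egn_wf k l g" and \<pi>: "bij_betw \<pi> {..<n} {..<m}"
    and X: "\<And>u v. u < n \<Longrightarrow> v < n \<Longrightarrow> X [u, v] = X' [\<pi> u, \<pi> v]"
    and u: "u < n"
  shows "row (apply_egn act g n X) u = row (apply_egn act g m X') (\<pi> u)"
proof -
  have pu: "\<pi> u < m" using \<pi> u by (auto simp: bij_betw_def)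
  have X2: "X a = X' (map \<pi> a)" if "set a \<subseteq> {..<n}" "length a = 2" for a
    using that X by (auto simp: length_Suc_conv numeral_2_eq_2)
  have "apply_layers act n (egn_layers g) X a = apply_layers act m (egn_layers g) X' (map \<pi> a)"
    if "set a \<subseteq> {..<n}" for a
    by (rule apply_layers_equivariant[OF \<pi>, where k=2]) (use g that X2 in \<open>auto simp: egn_wf_def\<close>)
  then have "apply_layer (egn_head g) n
      (\<lambda>a. apply_mlp act (egn_mlp g) (apply_layers act n (egn_layers g) X a)) [u] =
    apply_layer (egn_head g) m
      (\<lambda>a. apply_mlp act (egn_mlp g) (apply_layers act m (egn_layers g) X' a)) (map \<pi> [u])"
    using u by (intro apply_layer_equivariant[OF \<pi>]) (auto simp: multi_indices_def)
  then show ?thesis by (simp add: row_apply_egn[OF u] row_apply_egn[OF pu])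
qed

text \<open>With width \<open>1 + l\<close>, the transformer without layers returns its input.\<close>

lemma same_rows_if_APE_GT_indistinguishable:
  assumes "APE_GT_indistinguishable act l \<phi> G H"
  shows "same_rows (concat_cols (const_features G 1) (\<phi> G)) (concat_cols (const_features H 1) (\<phi> H))"
proof -
  define T where "T = \<lparr>nlayers = 0, width = 1 + l, nheads = 1, head_dim = 1, hidden_dim = 1,
    params = undefined\<rparr>"
  have T: "transformer_wf T" "width T = 1 + l" by (auto simp: transformer_wf_def T_def)
  have "same_rows
     (run_transformer act T plain_attention (concat_cols (const_features G 1) (\<phi> G)))
     (run_transformer act T plain_attention (concat_cols (const_features H 1) (\<phi> H)))"
    by (rule assms[unfolded APE_GT_indistinguishable_def, rule_format, OF T(1),
        THEN conjunct1, rule_format]) (use T in auto)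
  then show ?thesis by (simp add: run_transformer_def T_def)
qed

text \<open>The rows of \<open>B\<close> are the images of those of \<open>A\<close> under one function for both indices.\<close>

lemma same_rows_if_rows_determine:
  assumes same: "same_rows (A i) (A j)"
    and dim: "\<And>k. k \<in> {i, j} \<Longrightarrow> dim_row (B k) = dim_row (A k)"
    and det: "\<And>k k' u u'. k \<in> {i, j} \<Longrightarrow> k' \<in> {i, j} \<Longrightarrow> u < dim_row (A k) \<Longrightarrow>
      u' < dim_row (A k') \<Longrightarrow> row (A k) u = row (A k') u' \<Longrightarrow> row (B k) u = row (B k') u'"
  shows "same_rows (B i) (B j)"
proof -
  define F where "F r = (SOME s. \<exists>k\<in>{i, j}. \<exists>u<dim_row (A k). row (A k) u = r \<and> row (B k) u = s)" for r
  have F: "F (row (A k) u) = row (B k) u" if "k \<in> {i, j}" "u < dim_row (A k)" for k u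
    unfolding F_def
  proof (rule some_equality)
    show "\<exists>k'\<in>{i, j}. \<exists>u'<dim_row (A k'). row (A k') u' = row (A k) u \<and> row (B k') u' = row (B k) u"
      using that by blast
  next
    fix s
    assume "\<exists>k'\<in>{i, j}. \<exists>u'<dim_row (A k'). row (A k') u' = row (A k) u \<and> row (B k') u' = s"
    then show "s = row (B k) u" using det that by blast
  qed
  have "rows (B k) = map F (rows (A k))" if "k \<in> {i, j}" for k
    using that F dim[OF that] unfolding rows_def by simp
  then show ?thesis
    using same by (simp add: same_rows_def)
qed

section \<open>Colour refinement by 2-EGNs\<close>

text \<open>One separating weight vector is taken for each of the finitely many pairs of distinct
  multisets.\<close>

lemma finite_separating_weights:
  fixes \<M> :: "real vec multiset set"
  assumes act: "nonpolynomial_activation act" and fin: "finite \<M>"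
    and car: "\<And>M z. M \<in> \<M> \<Longrightarrow> z \<in># M \<Longrightarrow> z \<in> carrier_vec m"
    and cst: "k < m" "\<kappa> \<noteq> 0" "\<And>M z. M \<in> \<M> \<Longrightarrow> z \<in># M \<Longrightarrow> z $ k = \<kappa>"
  shows "\<exists>ws. set ws \<subseteq> carrier_vec m \<and> (\<forall>M\<in>\<M>. \<forall>N\<in>\<M>.
    (\<forall>w\<in>set ws. (\<Sum>z\<in>#M. act (w \<bullet> z)) = (\<Sum>z\<in>#N. act (w \<bullet> z))) \<longrightarrow> M = N)"
proof -
  have "\<exists>w. w \<in> carrier_vec m \<and> (\<Sum>z\<in>#M. act (w \<bullet> z)) \<noteq> (\<Sum>z\<in>#N. act (w \<bullet> z))"
    if "M \<in> \<M>" "N \<in> \<M>" "M \<noteq> N" for M N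
    using mset_eq_if_activation_sums_eq[OF act, of M N m k \<kappa>] car cst that by (metis union_iff)
  then obtain w where w: "\<And>M N. M \<in> \<M> \<Longrightarrow> N \<in> \<M> \<Longrightarrow> M \<noteq> N \<Longrightarrow> w M N \<in> carrier_vec m \<and>
      (\<Sum>z\<in>#M. act (w M N \<bullet> z)) \<noteq> (\<Sum>z\<in>#N. act (w M N \<bullet> z))"
    by metis
  define Q where "Q = {(M, N). M \<in> \<M> \<and> N \<in> \<M> \<and> M \<noteq> N}"
  have "finite Q" unfolding Q_def by (rule finite_subset[of _ "\<M> \<times> \<M>"]) (use fin in auto)
  then obtain ws where ws: "set ws = (\<lambda>(M, N). w M N) ` Q"
    using finite_list[of "(\<lambda>(M, N). w M N) ` Q"] by auto
  show ?thesis
  proof (intro exI[of _ ws] conjI ballI impI)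
    show "set ws \<subseteq> carrier_vec m" using w by (auto simp: ws Q_def)
  next
    fix M N assume MN: "M \<in> \<M>" "N \<in> \<M>"
      and eq: "\<forall>w\<in>set ws. (\<Sum>z\<in>#M. act (w \<bullet> z)) = (\<Sum>z\<in>#N. act (w \<bullet> z))"
    show "M = N"
    proof (rule ccontr)
      assume "M \<noteq> N"
      then have "w M N \<in> set ws" using MN by (auto simp: ws Q_def)
      then show False using eq w[OF MN \<open>M \<noteq> N\<close>] by blast
    qed
  qed
qed

text \<open>One matrix \<open>A\<close> serves three ends: the activated colours keep a nonzero
  constant channel, they still determine the pair colour, and their row sums determine the multiset
  of pair colours in the row.\<close>

lemma exists_separating_activation_layer:
  fixes n :: "'k \<Rightarrow> nat" and q :: "'k \<Rightarrow> nat \<Rightarrow> nat \<Rightarrow> real vec"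
  assumes act: "nonpolynomial_activation act" and fin: "finite \<K>"
    and car: "\<And>k u v. k \<in> \<K> \<Longrightarrow> u < n k \<Longrightarrow> v < n k \<Longrightarrow> q k u v \<in> carrier_vec m"
    and cst: "0 < m" "\<kappa> \<noteq> 0"
      "\<And>k u v. k \<in> \<K> \<Longrightarrow> u < n k \<Longrightarrow> v < n k \<Longrightarrow> q k u v $ 0 = \<kappa>"
  obtains d A \<kappa>' where "A \<in> carrier_mat d m" "0 < d" "\<kappa>' \<noteq> 0"
    "\<And>k u v. k \<in> \<K> \<Longrightarrow> u < n k \<Longrightarrow> v < n k \<Longrightarrow> map_vec act (A *\<^sub>v q k u v) $ 0 = \<kappa>'"
    "\<And>k k' u u' v v'. k \<in> \<K> \<Longrightarrow> k' \<in> \<K> \<Longrightarrow> u < n k \<Longrightarrow> u' < n k' \<Longrightarrow> v < n k \<Longrightarrow> v' < n k' \<Longrightarrow>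
      map_vec act (A *\<^sub>v q k u v) = map_vec act (A *\<^sub>v q k' u' v') \<Longrightarrow> q k u v = q k' u' v'"
    "\<And>k k' u u'. k \<in> \<K> \<Longrightarrow> k' \<in> \<K> \<Longrightarrow> u < n k \<Longrightarrow> u' < n k' \<Longrightarrow>
      (\<forall>j<d. (\<Sum>w<n k. map_vec act (A *\<^sub>v q k u w) $ j) =
              (\<Sum>w<n k'. map_vec act (A *\<^sub>v q k' u' w) $ j)) \<Longrightarrow>
      image_mset (q k u) (mset_set {..<n k}) = image_mset (q k' u') (mset_set {..<n k'})"
proof -
  define I where "I = (SIGMA k:\<K>. {..<n k})"
  \<comment> \<open>The row multisets are there for the sums, the singletons for injectivity on
    individual pair colours.\<close>
  define \<M> where "\<M> = (\<lambda>(k, u). image_mset (q k u) (mset_set {..<n k})) ` I \<union>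
    (\<Union>(k, u)\<in>I. (\<lambda>v. {#q k u v#}) ` {..<n k})"
  have "finite I" using fin by (auto simp: I_def)
  then have "finite \<M>" by (auto simp: \<M>_def)
  moreover have el: "z \<in> carrier_vec m \<and> z $ 0 = \<kappa>" if "M \<in> \<M>" "z \<in># M" for M z
    using that car cst(3) by (auto simp: \<M>_def I_def)
  ultimately obtain ws where ws: "set ws \<subseteq> carrier_vec m"
    "\<And>M N. M \<in> \<M> \<Longrightarrow> N \<in> \<M> \<Longrightarrow>
      (\<And>w. w \<in> set ws \<Longrightarrow> (\<Sum>z\<in>#M. act (w \<bullet> z)) = (\<Sum>z\<in>#N. act (w \<bullet> z))) \<Longrightarrow> M = N"
    using finite_separating_weights[OF act _ _ cst(1,2), of \<M>] by blast
  obtain \<tau> where \<tau>: "act \<tau> \<noteq> 0"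
    using act by (auto simp: nonpolynomial_activation_def fun_eq_iff dest: spec[of _ 0])
  \<comment> \<open>Every colour has \<open>\<kappa>\<close> at coordinate 0, so \<open>w0\<close>
    maps it to \<open>\<tau>\<close>, and \<open>act \<tau>\<close> is the next nonzero
    constant.\<close>
  define w0 where "w0 = (\<tau> / \<kappa>) \<cdot>\<^sub>v unit_vec m 0"
  define A where "A = mat_of_rows m (w0 # ws)"
  define d where "d = Suc (length ws)"
  have A: "A \<in> carrier_mat d m"
    using mat_of_rows_carrier(1)[of m "w0 # ws"] by (simp add: A_def d_def)
  have entry0: "map_vec act (A *\<^sub>v z) $ 0 = act (w0 \<bullet> z)" for z
    by (simp add: A_def w0_def)
  have entry: "map_vec act (A *\<^sub>v z) $ Suc j = act ((ws ! j) \<bullet> z)" if "j < length ws" for z j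
  proof -
    have "ws ! j \<in> carrier_vec m" using ws(1) that by auto
    then show ?thesis using that by (simp add: A_def)
  qed
  have cst': "map_vec act (A *\<^sub>v q k u v) $ 0 = act \<tau>" if "k \<in> \<K>" "u < n k" "v < n k" for k u v
  proof -
    have "unit_vec m 0 \<bullet> q k u v = \<kappa>"
      using car[OF that] cst(1) cst(3)[OF that] by simp
    then have "w0 \<bullet> q k u v = \<tau>"
      using cst(2) car[OF that] by (simp add: w0_def)
    then show ?thesis by (simp add: entry0)
  qed
  have single: "q k u v = q k' u' v'"
    if *: "k \<in> \<K>" "k' \<in> \<K>" "u < n k" "u' < n k'" "v < n k" "v' < n k'"
      and eq: "map_vec act (A *\<^sub>v q k u v) = map_vec act (A *\<^sub>v q k' u' v')" for k k' u u' v v'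
  proof -
    have "{#q k u v#} = {#q k' u' v'#}"
    proof (rule ws(2))
      fix w assume "w \<in> set ws"
      then obtain j where j: "j < length ws" "w = ws ! j" by (auto simp: in_set_conv_nth)
      show "(\<Sum>z\<in>#{#q k u v#}. act (w \<bullet> z)) = (\<Sum>z\<in>#{#q k' u' v'#}. act (w \<bullet> z))"
        using arg_cong[OF eq, of "\<lambda>x. x $ Suc j"] by (simp only: entry[OF j(1)] j(2)) simp
    qed (use * in \<open>auto simp: \<M>_def I_def\<close>)
    then show ?thesis by simp
  qed
  have multi: "image_mset (q k u) (mset_set {..<n k}) = image_mset (q k' u') (mset_set {..<n k'})"
    if *: "k \<in> \<K>" "k' \<in> \<K>" "u < n k" "u' < n k'"
      and eq: "\<forall>j<d. (\<Sum>w<n k. map_vec act (A *\<^sub>v q k u w) $ j) =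
              (\<Sum>w<n k'. map_vec act (A *\<^sub>v q k' u' w) $ j)" for k k' u u'
  proof (rule ws(2))
    fix w assume "w \<in> set ws"
    then obtain j where j: "j < length ws" "w = ws ! j" by (auto simp: in_set_conv_nth)
    show "(\<Sum>z\<in>#image_mset (q k u) (mset_set {..<n k}). act (w \<bullet> z)) =
        (\<Sum>z\<in>#image_mset (q k' u') (mset_set {..<n k'}). act (w \<bullet> z))"
      using eq[rule_format, of "Suc j"] j
      by (simp only: entry[OF j(1)]) (simp add: d_def sum_unfold_sum_mset multiset.map_comp comp_def)
  next
    show "image_mset (q k u) (mset_set {..<n k}) \<in> \<M>"
      "image_mset (q k' u') (mset_set {..<n k'}) \<in> \<M>"
      using * by (auto simp: \<M>_def I_def)
  qed
  have "0 < d" by (simp add: d_def)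
  show ?thesis by (rule that[OF A \<open>0 < d\<close> \<tau> cst' single multi])
qed

text \<open>In an equality pattern of an input index \<open>a\<close> followed by an output index \<open>b\<close>, the positions of
  \<open>a\<close> are 0 and 1, those of \<open>b\<close> are 2 and 3.\<close>

definition reads :: "nat \<Rightarrow> (nat \<times> nat) set \<Rightarrow> bool" where
  "reads i \<gamma> =
    (if i = 0 then (0, 1) \<in> \<gamma> \<and> (0, 2) \<in> \<gamma>
     else if i = 1 then (0, 1) \<in> \<gamma> \<and> (0, 3) \<in> \<gamma>
     else if i = 2 then (0, 2) \<in> \<gamma> \<and> (1, 3) \<in> \<gamma>
     else if i = 3 then (0, 2) \<in> \<gamma>
     else (0, 3) \<in> \<gamma>)"

text \<open>The five readouts at \<open>(u, v)\<close> are the two diagonal entries, the pair entry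
  and the row sums of \<open>u\<close> and of \<open>v\<close>. Diagonal and pair entries supply the
  resistance distance and the constant; the row sums update the states at both ends.\<close>

definition readout :: "nat \<Rightarrow> tensor \<Rightarrow> nat \<Rightarrow> nat \<Rightarrow> nat \<Rightarrow> nat \<Rightarrow> real" where
  "readout n X u v i c =
    (\<Sum>a\<in>multi_indices n 2. if reads i (eq_pattern (a @ [u, v])) then X a $ c else 0)"

definition context_vec :: "nat \<Rightarrow> nat \<Rightarrow> tensor \<Rightarrow> nat \<Rightarrow> nat \<Rightarrow> real vec" where
  "context_vec n d X u v = vec (5 * d) (\<lambda>j. readout n X u v (j div d) (j mod d))"

text \<open>Realises an arbitrary matrix \<open>A\<close> acting on the five readouts as an
  equivariant layer. One equality pattern can contribute to several readouts, so its coefficient is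
  the sum of the corresponding column blocks of \<open>A\<close>.\<close>

definition context_layer :: "nat \<Rightarrow> real mat \<Rightarrow> equiv_layer" where
  "context_layer d A = \<lparr>ord_in = 2, dim_in = d, ord_out = 2, dim_out = dim_row A,
     coeff = (\<lambda>\<gamma>. mat (dim_row A) d
       (\<lambda>(r, c). \<Sum>i<5. if reads i \<gamma> then A $$ (r, i * d + c) else 0))\<rparr>"

lemma sum_multi_indices_2:
  "(\<Sum>a\<in>multi_indices n 2. f a) = (\<Sum>x<n. \<Sum>y<n. f [x, y])"
proof -
  have "bij_betw (\<lambda>(x, y). [x, y]) ({..<n} \<times> {..<n}) (multi_indices n 2)"
    by (rule bij_betwI[where g="\<lambda>a. (a ! 0, a ! 1)"])
      (auto simp: multi_indices_def numeral_2_eq_2 length_Suc_conv)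
  from sum.reindex_bij_betw[OF this, of f, symmetric] show ?thesis
    by (simp add: sum.cartesian_product case_prod_unfold)
qed

lemma eq_pattern_4:
  "(0, 1) \<in> eq_pattern [x, y, u, v] \<longleftrightarrow> x = y" "(0, 2) \<in> eq_pattern [x, y, u, v] \<longleftrightarrow> x = u"
  "(0, 3) \<in> eq_pattern [x, y, u, v] \<longleftrightarrow> x = v" "(1, 3) \<in> eq_pattern [x, y, u, v] \<longleftrightarrow> y = v"
  by (auto simp: eq_pattern_def numeral_2_eq_2 numeral_3_eq_3)

lemma readout_simps:
  assumes "u < n" "v < n"
  shows "readout n X u v 0 c = X [u, u] $ c" "readout n X u v 1 c = X [v, v] $ c"
    "readout n X u v 2 c = X [u, v] $ c" "readout n X u v 3 c = (\<Sum>w<n. X [u, w] $ c)"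
    "readout n X u v 4 c = (\<Sum>w<n. X [v, w] $ c)"
proof -
  have pick: "(\<Sum>x<n. \<Sum>y<n. if x = a \<and> y = b then f x y else 0) = f a b"
    if "a < n" "b < n" for a b and f :: "nat \<Rightarrow> nat \<Rightarrow> real"
  proof -
    have "(\<Sum>y<n. if x = a \<and> y = b then f x y else 0) = (if x = a then f a b else 0)" for x
      using that by (cases "x = a") simp_all
    then show ?thesis using that by simp
  qed
  have pick': "(\<Sum>x<n. \<Sum>y<n. if x = a then f x y else 0) = (\<Sum>y<n. f a y)"
    if "a < n" for a and f :: "nat \<Rightarrow> nat \<Rightarrow> real"
    using that by (subst sum.swap) simp
  have diag: "(\<Sum>x<n. \<Sum>y<n. if x = y \<and> x = a then f x y else 0) = f a a"
    if "a < n" for a and f :: "nat \<Rightarrow> nat \<Rightarrow> real"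
  proof -
    have "(\<Sum>x<n. \<Sum>y<n. if x = y \<and> x = a then f x y else 0) =
        (\<Sum>x<n. \<Sum>y<n. if x = a \<and> y = a then f x y else 0)"
      by (intro sum.cong refl if_cong) auto
    then show ?thesis using pick[OF that that] by simp
  qed
  show "readout n X u v 0 c = X [u, u] $ c" "readout n X u v 1 c = X [v, v] $ c"
    "readout n X u v 2 c = X [u, v] $ c" "readout n X u v 3 c = (\<Sum>w<n. X [u, w] $ c)"
    "readout n X u v 4 c = (\<Sum>w<n. X [v, w] $ c)"
    using assms
    by (simp_all add: readout_def sum_multi_indices_2 reads_def eq_pattern_4 diag pick pick'
        del: One_nat_def)
qed

lemma context_vec_eqD:
  assumes "context_vec n d X u v = context_vec n' d X' u' v'" "i < 5" "c < d"
  shows "readout n X u v i c = readout n' X' u' v' i c"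
proof -
  have "i * d + c < Suc i * d" using assms(3) by simp
  also have "\<dots> \<le> 5 * d" using assms(2) by (intro mult_le_mono1) simp
  finally have "i * d + c < 5 * d" .
  then show ?thesis
    using arg_cong[OF assms(1), of "\<lambda>x. x $ (i * d + c)"] assms(3) by (simp add: context_vec_def)
qed

lemma context_layer_wf: "equiv_layer_wf (context_layer d A)"
  by (auto simp: equiv_layer_wf_def context_layer_def)

lemma apply_context_layer:
  assumes A: "A \<in> carrier_mat d' (5 * d)"
    and X: "\<And>a. a \<in> multi_indices n 2 \<Longrightarrow> dim_vec (X a) = d"
  shows "apply_layer (context_layer d A) n X [u, v] = A *\<^sub>v context_vec n d X u v"
proof (rule eq_vecI)
  fix r assume "r < dim_vec (A *\<^sub>v context_vec n d X u v)"
  then have r: "r < d'" using A by simp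
  let ?s = "\<lambda>i a. if reads i (eq_pattern (a @ [u, v])) then 1 else 0 :: real"
  have "apply_layer (context_layer d A) n X [u, v] $ r =
     (\<Sum>a\<in>multi_indices n 2. \<Sum>c<d. (\<Sum>i<5. ?s i a * A $$ (r, i * d + c)) * X a $ c)"
    using A r X
    by (auto simp: apply_layer_def context_layer_def scalar_prod_def lessThan_atLeast0
        intro!: sum.cong)
  also have "\<dots> = (\<Sum>a\<in>multi_indices n 2. \<Sum>i<5. \<Sum>c<d. A $$ (r, i * d + c) * (?s i a * X a $ c))"
    by (simp only: sum_distrib_right, subst sum.swap) (simp only: mult_ac)
  also have "\<dots> = (\<Sum>i<5. \<Sum>c<d. A $$ (r, i * d + c) * (\<Sum>a\<in>multi_indices n 2. ?s i a * X a $ c))"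
    by (subst sum.swap, intro sum.cong refl, subst sum.swap) (simp only: sum_distrib_left)
  also have "\<dots> = (\<Sum>i<5. \<Sum>c<d. A $$ (r, i * d + c) * readout n X u v i c)"
    by (auto simp: readout_def intro!: sum.cong)
  \<comment> \<open>Readout \<open>i\<close> and channel \<open>c\<close> are merged into the single
    column index \<open>i * d + c\<close> of \<open>A\<close>.\<close>
  also have "\<dots> = (\<Sum>i<5. \<Sum>j\<in>{i * d..<i * d + d}. A $$ (r, j) * readout n X u v (j div d) (j mod d))"
  proof (rule sum.cong[OF refl])
    fix i
    show "(\<Sum>c<d. A $$ (r, i * d + c) * readout n X u v i c) =
        (\<Sum>j\<in>{i * d..<i * d + d}. A $$ (r, j) * readout n X u v (j div d) (j mod d))"
      by (rule sum.reindex_bij_witness[of _ "\<lambda>j. j - i * d" "\<lambda>c. i * d + c"]) auto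
  qed
  also have "\<dots> = (\<Sum>j<5 * d. A $$ (r, j) * readout n X u v (j div d) (j mod d))"
    by (rule sum.nat_group)
  also have "\<dots> = (A *\<^sub>v context_vec n d X u v) $ r"
    using A r by (simp add: scalar_prod_def context_vec_def lessThan_atLeast0)
  finally show "apply_layer (context_layer d A) n X [u, v] $ r = (A *\<^sub>v context_vec n d X u v) $ r" .
qed (use A in \<open>simp add: apply_layer_def context_layer_def\<close>)

text \<open>\<open>s'\<close> is coarser than one round of colour refinement applied to \<open>s\<close>, with edge colours \<open>\<psi>\<close>.\<close>

definition refinement_determines ::
    "'k set \<Rightarrow> ('k \<Rightarrow> nat) \<Rightarrow> ('k \<Rightarrow> nat \<Rightarrow> nat \<Rightarrow> 'e) \<Rightarrow> ('k \<Rightarrow> nat \<Rightarrow> 's) \<Rightarrow> ('k \<Rightarrow> nat \<Rightarrow> 's) \<Rightarrow> bool" where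
  "refinement_determines \<K> n \<psi> s s' \<longleftrightarrow> (\<forall>k\<in>\<K>. \<forall>k'\<in>\<K>. \<forall>u<n k. \<forall>u'<n k'.
     s k u = s k' u' \<longrightarrow>
     image_mset (\<lambda>w. (\<psi> k u w, s k w)) (mset_set {..<n k}) =
       image_mset (\<lambda>w. (\<psi> k' u' w, s k' w)) (mset_set {..<n k'}) \<longrightarrow>
     s' k u = s' k' u')"

text \<open>The invariant of the layer induction, required across all graphs of the family. It
  includes both ends of a pair because the row of \<open>u\<close> is refined by the states at the
  second ends \<open>w\<close>.\<close>

definition context_determines ::
    "'k set \<Rightarrow> ('k \<Rightarrow> nat) \<Rightarrow> ('k \<Rightarrow> nat \<Rightarrow> nat \<Rightarrow> 'q) \<Rightarrow>
      ('k \<Rightarrow> nat \<Rightarrow> nat \<Rightarrow> 'e) \<Rightarrow> ('k \<Rightarrow> nat \<Rightarrow> 's) \<Rightarrow> bool" where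
  "context_determines \<K> n q \<psi> s \<longleftrightarrow> (\<forall>k\<in>\<K>. \<forall>k'\<in>\<K>. \<forall>u<n k. \<forall>u'<n k'. \<forall>v<n k. \<forall>v'<n k'.
     q k u v = q k' u' v' \<longrightarrow> \<psi> k u v = \<psi> k' u' v' \<and> s k u = s k' u' \<and> s k v = s k' v')"

text \<open>One function \<open>F\<close>, common to all graphs of the family, turns a pair colour
  into the pair of edge colour and state; it is applied to both multisets.\<close>

lemma context_determines_mset:
  assumes det: "context_determines \<K> n q \<psi> s"
    and k: "k \<in> \<K>" "k' \<in> \<K>" "u < n k" "u' < n k'"
    and eq: "image_mset (q k u) (mset_set {..<n k}) = image_mset (q k' u') (mset_set {..<n k'})"
  shows "image_mset (\<lambda>w. (\<psi> k u w, s k w)) (mset_set {..<n k}) =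
    image_mset (\<lambda>w. (\<psi> k' u' w, s k' w)) (mset_set {..<n k'})"
proof -
  define F where "F z = (SOME p. \<exists>k\<in>\<K>. \<exists>u<n k. \<exists>w<n k. q k u w = z \<and> p = (\<psi> k u w, s k w))" for z
  have F: "F (q k u w) = (\<psi> k u w, s k w)" if "k \<in> \<K>" "u < n k" "w < n k" for k u w
    unfolding F_def
  proof (rule some_equality)
    show "\<exists>k'\<in>\<K>. \<exists>u'<n k'. \<exists>w'<n k'. q k' u' w' = q k u w \<and> (\<psi> k u w, s k w) = (\<psi> k' u' w', s k' w')"
      using that by blast
  next
    fix p
    assume "\<exists>k'\<in>\<K>. \<exists>u'<n k'. \<exists>w'<n k'. q k' u' w' = q k u w \<and> p = (\<psi> k' u' w', s k' w')"
    then obtain k' u' w' where "k' \<in> \<K>" "u' < n k'" "w' < n k'" "q k' u' w' = q k u w"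
      "p = (\<psi> k' u' w', s k' w')" by blast
    then show "p = (\<psi> k u w, s k w)" using det that unfolding context_determines_def by metis
  qed
  have "image_mset F (image_mset (q k u) (mset_set {..<n k})) =
      image_mset (\<lambda>w. (\<psi> k u w, s k w)) (mset_set {..<n k})" if "k \<in> \<K>" "u < n k" for k u
    using F[OF that] by (auto simp: multiset.map_comp intro!: image_mset_cong)
  then show ?thesis using eq k by metis
qed

abbreviation composable :: "equiv_layer \<Rightarrow> equiv_layer \<Rightarrow> bool" where
  "composable L L' \<equiv> ord_in L' = ord_out L \<and> dim_in L' = dim_out L"

text \<open>Induction on the number of rounds: the first layer with its activation replaces
  \<open>W\<close> by \<open>W'\<close>, whose contexts determine the states one round later, so the
  hypothesis applies to \<open>W'\<close> and the shifted sequence. This is why \<open>W\<close>,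
  \<open>d\<close>, \<open>\<kappa>\<close> and \<open>s\<close> are all general.\<close>

lemma equiv_layers_compute_refinement:
  fixes n :: "'k \<Rightarrow> nat" and \<psi> :: "'k \<Rightarrow> nat \<Rightarrow> nat \<Rightarrow> 'e" and s :: "nat \<Rightarrow> 'k \<Rightarrow> nat \<Rightarrow> 's"
  assumes act: "nonpolynomial_activation act" and fin: "finite \<K>"
    and W: "\<And>k a. k \<in> \<K> \<Longrightarrow> a \<in> multi_indices (n k) 2 \<Longrightarrow> dim_vec (W k a) = d"
      "0 < d" "\<kappa> \<noteq> 0" "\<And>k u. k \<in> \<K> \<Longrightarrow> u < n k \<Longrightarrow> W k [u, u] $ 0 = \<kappa>"
    and init: "context_determines \<K> n (\<lambda>k. context_vec (n k) d (W k)) \<psi> (s 0)"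
    and step: "\<And>t. t < r \<Longrightarrow> refinement_determines \<K> n \<psi> (s t) (s (Suc t))"
  shows "\<exists>Ls. Ls \<noteq> [] \<and> (\<forall>L\<in>set Ls. equiv_layer_wf L) \<and>
    ord_in (hd Ls) = 2 \<and> dim_in (hd Ls) = d \<and> successively composable Ls \<and> ord_out (last Ls) = 2 \<and>
    (\<forall>k\<in>\<K>. \<forall>k'\<in>\<K>. \<forall>u<n k. \<forall>u'<n k'.
      apply_layers act (n k) Ls (W k) [u, u] = apply_layers act (n k') Ls (W k') [u', u'] \<longrightarrow>
      s r k u = s r k' u')"
  using W init step
proof (induction r arbitrary: s W d \<kappa>)
  case 0
  \<comment> \<open>No activation follows the last layer, so with the identity it outputs the
    context vector itself.\<close>
  let ?L = "context_layer d (1\<^sub>m (5 * d))"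
  have out: "apply_layer ?L (n k) (W k) [u, u] = context_vec (n k) d (W k) u u"
    if "k \<in> \<K>" for k u
    using apply_context_layer[of "1\<^sub>m (5 * d)" "5 * d" d "n k" "W k" u u] 0(1) that
    by (simp add: context_vec_def)
  have sep: "s 0 k u = s 0 k' u'"
    if "k \<in> \<K>" "k' \<in> \<K>" "u < n k" "u' < n k'"
      "apply_layer ?L (n k) (W k) [u, u] = apply_layer ?L (n k') (W k') [u', u']" for k k' u u'
    using 0(5)[unfolded context_determines_def] that out by metis
  have L: "ord_in ?L = 2" "dim_in ?L = d" "ord_out ?L = 2" by (simp_all add: context_layer_def)
  show ?case
  proof (intro exI[of _ "[?L]"] conjI ballI allI impI)
    fix k k' u u'
    assume "k \<in> \<K>" "k' \<in> \<K>" "u < n k" "u' < n k'"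
      "apply_layers act (n k) [?L] (W k) [u, u] = apply_layers act (n k') [?L] (W k') [u', u']"
    then show "s 0 k u = s 0 k' u'" by (intro sep) simp_all
  qed (use L context_layer_wf in auto)
next
  case (Suc r)
  define q where "q k = context_vec (n k) d (W k)" for k
  \<comment> \<open>The constant is assumed on the diagonal only; readout 0 copies the entry at
    \<open>[u, u]\<close> to every pair \<open>(u, v)\<close>.\<close>
  have q0: "q k u v $ 0 = \<kappa>" if "k \<in> \<K>" "u < n k" "v < n k" for k u v
    using Suc.prems(2,4) that readout_simps(1)[OF that(2,3)] by (simp add: q_def context_vec_def)
  have qc: "q k u v \<in> carrier_vec (5 * d)" for k u v
    by (simp add: q_def context_vec_def)
  have "0 < 5 * d" using Suc.prems(2) by simp
  obtain d' A \<kappa>' where A: "A \<in> carrier_mat d' (5 * d)" "0 < d'" "\<kappa>' \<noteq> 0"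
    and A0: "\<And>k u v. k \<in> \<K> \<Longrightarrow> u < n k \<Longrightarrow> v < n k \<Longrightarrow> map_vec act (A *\<^sub>v q k u v) $ 0 = \<kappa>'"
    and A1: "\<And>k k' u u' v v'. k \<in> \<K> \<Longrightarrow> k' \<in> \<K> \<Longrightarrow> u < n k \<Longrightarrow> u' < n k' \<Longrightarrow> v < n k \<Longrightarrow> v' < n k' \<Longrightarrow>
      map_vec act (A *\<^sub>v q k u v) = map_vec act (A *\<^sub>v q k' u' v') \<Longrightarrow> q k u v = q k' u' v'"
    and A2: "\<And>k k' u u'. k \<in> \<K> \<Longrightarrow> k' \<in> \<K> \<Longrightarrow> u < n k \<Longrightarrow> u' < n k' \<Longrightarrow>
      (\<forall>j<d'. (\<Sum>w<n k. map_vec act (A *\<^sub>v q k u w) $ j) =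
              (\<Sum>w<n k'. map_vec act (A *\<^sub>v q k' u' w) $ j)) \<Longrightarrow>
      image_mset (q k u) (mset_set {..<n k}) = image_mset (q k' u') (mset_set {..<n k'})"
    by (rule exists_separating_activation_layer[where q=q and n=n,
          OF act fin qc \<open>0 < 5 * d\<close> Suc.prems(3) q0]) (assumption | rule that)+
  define L where "L = context_layer d A"
  define W' where "W' k = (\<lambda>a. map_vec act (apply_layer L (n k) (W k) a))" for k
  have dimW': "dim_vec (W' k a) = d'" for k a
    using A(1) by (simp add: W'_def L_def apply_layer_def context_layer_def)
  have W': "W' k [u, v] = map_vec act (A *\<^sub>v q k u v)" if "k \<in> \<K>" for k u v
    using apply_context_layer[OF A(1) Suc.prems(1)[OF that]] by (simp add: W'_def L_def q_def)
  have det: "context_determines \<K> n (\<lambda>k. context_vec (n k) d' (W' k)) \<psi> (s (Suc 0))"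
    unfolding context_determines_def
  proof (intro ballI allI impI)
    fix k k' u u' v v'
    assume k: "k \<in> \<K>" "k' \<in> \<K>" and u: "u < n k" "u' < n k'" and v: "v < n k" "v' < n k'"
      and eq: "context_vec (n k) d' (W' k) u v = context_vec (n k') d' (W' k') u' v'"
    \<comment> \<open>Readout 2 retains the activated colour of the pair and thereby, by
      injectivity, everything known before this round.\<close>
    have "W' k [u, v] = W' k' [u', v']"
      using context_vec_eqD[OF eq, of 2] readout_simps(3)[OF u(1) v(1)] readout_simps(3)[OF u(2) v(2)]
      by (intro eq_vecI) (auto simp: dimW')
    then have "q k u v = q k' u' v'" using A1 k u v by (simp add: W')
    then have now: "\<psi> k u v = \<psi> k' u' v'" "s 0 k u = s 0 k' u'" "s 0 k v = s 0 k' v'"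
      using Suc.prems(5) k u v unfolding context_determines_def q_def by blast+
    \<comment> \<open>Readout 3 is the row sum at \<open>u\<close>, from which the layer recovers
      the row multiset; readout 4 does the same at \<open>v\<close> below.\<close>
    have "image_mset (q k u) (mset_set {..<n k}) = image_mset (q k' u') (mset_set {..<n k'})"
      using context_vec_eqD[OF eq, of 3] readout_simps(4)[OF u(1) v(1)] readout_simps(4)[OF u(2) v(2)]
      by (intro A2 k u) (auto simp: W'[OF k(1)] W'[OF k(2)])
    from context_determines_mset[OF Suc.prems(5)[folded q_def] k u this]
    have "s (Suc 0) k u = s (Suc 0) k' u'"
      using Suc.prems(6)[of 0] k u now unfolding refinement_determines_def by blast
    moreover have "image_mset (q k v) (mset_set {..<n k}) = image_mset (q k' v') (mset_set {..<n k'})"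
      using context_vec_eqD[OF eq, of 4] readout_simps(5)[OF u(1) v(1)] readout_simps(5)[OF u(2) v(2)]
      by (intro A2 k v) (auto simp: W'[OF k(1)] W'[OF k(2)])
    from context_determines_mset[OF Suc.prems(5)[folded q_def] k v this]
    have "s (Suc 0) k v = s (Suc 0) k' v'"
      using Suc.prems(6)[of 0] k v now unfolding refinement_determines_def by blast
    ultimately show "\<psi> k u v = \<psi> k' u' v' \<and> s (Suc 0) k u = s (Suc 0) k' u' \<and> s (Suc 0) k v = s (Suc 0) k' v'"
      using now by blast
  qed
  have "\<exists>Ls. Ls \<noteq> [] \<and> (\<forall>L\<in>set Ls. equiv_layer_wf L) \<and>
    ord_in (hd Ls) = 2 \<and> dim_in (hd Ls) = d' \<and> successively composable Ls \<and> ord_out (last Ls) = 2 \<and>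
    (\<forall>k\<in>\<K>. \<forall>k'\<in>\<K>. \<forall>u<n k. \<forall>u'<n k'.
      apply_layers act (n k) Ls (W' k) [u, u] = apply_layers act (n k') Ls (W' k') [u', u'] \<longrightarrow>
      s (Suc r) k u = s (Suc r) k' u')"
    by (rule Suc.IH[of W' d' \<kappa>' "\<lambda>t. s (Suc t)"]) (use dimW' A W' A0 det Suc.prems(6) in auto)
  then obtain Ls where Ls: "Ls \<noteq> []" "\<forall>L\<in>set Ls. equiv_layer_wf L"
    "ord_in (hd Ls) = 2" "dim_in (hd Ls) = d'" "successively composable Ls" "ord_out (last Ls) = 2"
    "\<forall>k\<in>\<K>. \<forall>k'\<in>\<K>. \<forall>u<n k. \<forall>u'<n k'.
      apply_layers act (n k) Ls (W' k) [u, u] = apply_layers act (n k') Ls (W' k') [u', u'] \<longrightarrow>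
      s (Suc r) k u = s (Suc r) k' u'"
    by blast
  have L: "equiv_layer_wf L" "ord_in L = 2" "dim_in L = d" "ord_out L = 2" "dim_out L = d'"
    using context_layer_wf A(1) by (auto simp: L_def, auto simp: context_layer_def)
  have shift: "apply_layers act (n k) (L # Ls) (W k) = apply_layers act (n k) Ls (W' k)" for k
    using Ls(1) by (cases Ls) (auto simp: W'_def)
  show ?case
  proof (rule exI[of _ "L # Ls"], unfold shift, intro conjI Ls(7))
    show "successively composable (L # Ls)"
      using L(4,5) Ls(1,3-5) by (simp add: successively_Cons)
  qed (use L(1-3) Ls(1,2,6) in simp_all)
qed

lemma dim_apply_layers:
  "Ls \<noteq> [] \<Longrightarrow> dim_vec (apply_layers act n Ls X b) = dim_out (last Ls)"
  by (induction act n Ls X rule: apply_layers.induct) (auto simp: apply_layer_def)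

text \<open>An empty MLP and a head that picks the diagonal entry at \<open>[u, u]\<close> turn the
  last layer into a node output without loss.\<close>

theorem egn_computes_refinement:
  fixes n :: "'k \<Rightarrow> nat" and \<psi> :: "'k \<Rightarrow> nat \<Rightarrow> nat \<Rightarrow> 'e" and s :: "nat \<Rightarrow> 'k \<Rightarrow> nat \<Rightarrow> 's"
  assumes act: "nonpolynomial_activation act" and fin: "finite \<K>"
    and W: "\<And>k a. k \<in> \<K> \<Longrightarrow> a \<in> multi_indices (n k) 2 \<Longrightarrow> dim_vec (W k a) = d"
      "0 < d" "\<kappa> \<noteq> 0" "\<And>k u. k \<in> \<K> \<Longrightarrow> u < n k \<Longrightarrow> W k [u, u] $ 0 = \<kappa>"
    and init: "context_determines \<K> n (\<lambda>k. context_vec (n k) d (W k)) \<psi> (s 0)"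
    and step: "\<And>t. t < r \<Longrightarrow> refinement_determines \<K> n \<psi> (s t) (s (Suc t))"
  shows "\<exists>l g. egn_wf d l g \<and> (\<forall>k\<in>\<K>. \<forall>k'\<in>\<K>. \<forall>u<n k. \<forall>u'<n k'.
    row (apply_egn act g (n k) (W k)) u = row (apply_egn act g (n k') (W k')) u' \<longrightarrow>
    s r k u = s r k' u')"
proof -
  from equiv_layers_compute_refinement[where W=W and s=s and n=n and \<psi>=\<psi>, OF assms]
  obtain Ls where Ls: "Ls \<noteq> []" "\<forall>L\<in>set Ls. equiv_layer_wf L"
    "ord_in (hd Ls) = 2" "dim_in (hd Ls) = d" "successively composable Ls" "ord_out (last Ls) = 2"
    "\<forall>k\<in>\<K>. \<forall>k'\<in>\<K>. \<forall>u<n k. \<forall>u'<n k'.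
      apply_layers act (n k) Ls (W k) [u, u] = apply_layers act (n k') Ls (W k') [u', u'] \<longrightarrow>
      s r k u = s r k' u'"
    by blast
  define l where "l = dim_out (last Ls)"
  define h where "h = \<lparr>ord_in = 2, dim_in = l, ord_out = 1, dim_out = l,
    coeff = (\<lambda>\<gamma>. if (0, 1) \<in> \<gamma> \<and> (0, 2) \<in> \<gamma> then 1\<^sub>m l else 0\<^sub>m l l)\<rparr>"
  define g where "g = \<lparr>egn_layers = Ls, egn_mlp = [], egn_head = h\<rparr>"
  have wf: "egn_wf d l g"
    using Ls(1-6) by (auto simp: egn_wf_def g_def h_def l_def equiv_layer_wf_def)
  have row: "row (apply_egn act g m X) u = apply_layers act m Ls X [u, u]" if "u < m" for m X u
  proof -
    let ?Z = "apply_layers act m Ls X"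
    have dim: "?Z a \<in> carrier_vec l" for a
      using dim_apply_layers[OF Ls(1)] by (auto simp: l_def intro: carrier_vecI)
    have pat: "(0, 1) \<in> eq_pattern [x, y, u] \<and> (0, 2) \<in> eq_pattern [x, y, u] \<longleftrightarrow> x = u \<and> y = u" for x y
      by (auto simp: eq_pattern_def numeral_2_eq_2)
    have "apply_layer h m ?Z [u] $ j = ?Z [u, u] $ j" if "j < l" for j
    proof -
      have "apply_layer h m ?Z [u] $ j =
          (\<Sum>x<m. \<Sum>y<m. if x = u \<and> y = u then ?Z [x, y] $ j else 0)"
        using that dim unfolding apply_layer_def h_def
        by (auto simp: sum_multi_indices_2 pat simp del: One_nat_def intro!: sum.cong)
      also have "\<dots> = (\<Sum>x<m. if x = u then ?Z [u, u] $ j else 0)"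
      proof (rule sum.cong[OF refl])
        fix x
        show "(\<Sum>y<m. if x = u \<and> y = u then ?Z [x, y] $ j else 0) = (if x = u then ?Z [u, u] $ j else 0)"
          using \<open>u < m\<close> by (cases "x = u") simp_all
      qed
      finally show ?thesis using \<open>u < m\<close> by simp
    qed
    moreover have "dim_out h = l" by (simp add: h_def)
    ultimately show ?thesis
      using dim[of "[u, u]"] by (intro eq_vecI) (simp_all add: row_apply_egn[OF that] g_def)
  qed
  show ?thesis
  proof (intro exI[of _ l] exI[of _ g] conjI wf ballI allI impI)
    fix k k' u u'
    assume "k \<in> \<K>" "k' \<in> \<K>" "u < n k" "u' < n k'"
      and "row (apply_egn act g (n k) (W k)) u = row (apply_egn act g (n k') (W k')) u'"
    then show "s r k u = s r k' u'" using Ls(7)[rule_format, of k k' u u'] by (simp only: row)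
  qed
qed

section \<open>Transformers with relative positional encoding\<close>

lemma row_mult_eq:
  assumes "row X u = row X' u'" "u < dim_row X" "u' < dim_row X'"
  shows "row (X * M) u = row (X' * M) u'"
  using assms by (intro eq_vecI) simp_all

lemma row_add_eq:
  assumes "row X u = row X' u'" "row Y u = row Y' u'" "X \<in> carrier_mat n d" "Y \<in> carrier_mat n d"
    "X' \<in> carrier_mat n' d" "Y' \<in> carrier_mat n' d" "u < n" "u' < n'"
  shows "row (X + Y) u = row (X' + Y') u'"
  using assms by simp

lemma row_map_mat_eq:
  assumes "row X u = row X' u'" "u < dim_row X" "u' < dim_row X'"
  shows "row (map_mat f X) u = row (map_mat f X') u'"
proof -
  have "row (map_mat f Z) w = map_vec f (row Z w)" if "w < dim_row Z" for Z w
    using that by (intro eq_vecI) simp_all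
  then show ?thesis using assms by simp
qed

lemma sum_eq_if_image_mset_eq:
  fixes f f' :: "nat \<Rightarrow> 'a"
  assumes "image_mset f (mset_set {..<n}) = image_mset f' (mset_set {..<n'})"
  shows "(\<Sum>w<n. F (f w)) = (\<Sum>w<n'. F (f' w))"
proof -
  have "(\<Sum>w<m. F (g w)) = sum_mset (image_mset F (image_mset g (mset_set {..<m})))"
    for m and g :: "nat \<Rightarrow> 'a"
    by (simp add: sum_unfold_sum_mset multiset.map_comp comp_def)
  then show ?thesis using assms by metis
qed

definition score :: "nat \<Rightarrow> head \<Rightarrow> real vec \<Rightarrow> real vec \<Rightarrow> real" where
  "score dh a x y = 1 / sqrt (real dh) * (\<Sum>i<dh. (x \<bullet> col (WQ a) i) * (y \<bullet> col (WK a) i))"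

lemma scores_entry:
  assumes "X \<in> carrier_mat n d" "WQ a \<in> carrier_mat d dh" "WK a \<in> carrier_mat d dh" "u < n" "v < n"
  shows "scores dh a X $$ (u, v) = score dh a (row X u) (row X v)"
  using assms by (simp add: scores_def score_def scalar_prod_def[of "row _ _" "col _ _"] lessThan_atLeast0)
    (auto simp: scalar_prod_def intro!: sum.cong)

text \<open>The unnormalised softmax weight, taking edge colour and state as one pair so that sums
  over \<open>w\<close> depend only on the multiset of such pairs.\<close>

definition rpe_weight ::
    "nat \<Rightarrow> head \<Rightarrow> ('e \<Rightarrow> real) \<Rightarrow> real vec \<Rightarrow> 'e \<times> real vec \<Rightarrow> real" where
  "rpe_weight dh a f x = (\<lambda>(e, y). exp (score dh a x y + f e))"

lemma RPE_attention_entry: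
  assumes X: "X \<in> carrier_mat n d" and W: "WQ a \<in> carrier_mat d dh" "WK a \<in> carrier_mat d dh"
    and uv: "u < n" "v < n"
  shows "RPE_attention \<psi> f1 f2 t h (scores dh a X) $$ (u, v) =
    f1 t h (\<psi> u v) * (rpe_weight dh a (f2 t h) (row X u) (\<psi> u v, row X v) /
      (\<Sum>w<n. rpe_weight dh a (f2 t h) (row X u) (\<psi> u w, row X w)))"
proof -
  have S: "scores dh a X \<in> carrier_mat n n"
    by (rule carrier_matI) (use X W in \<open>simp_all add: scores_def\<close>)
  show ?thesis
    using S uv scores_entry[OF X W uv(1)]
    by (simp add: RPE_attention_def softmax_rows_def rpe_weight_def Let_def)
qed

lemma RPE_attention_carrier:
  assumes "X \<in> carrier_mat n d" "WQ a \<in> carrier_mat d dh" "WK a \<in> carrier_mat d dh"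
  shows "RPE_attention \<psi> f1 f2 t h (scores dh a X) \<in> carrier_mat n n"
  by (rule carrier_matI) (use assms in \<open>simp_all add: RPE_attention_def scores_def Let_def\<close>)

text \<open>Both the softmax normalisation and the attention average are sums over the vertices \<open>w\<close> of
  a function of \<open>(\<psi> u w, row X w)\<close>.\<close>

lemma row_RPE_attention_mult:
  assumes X: "X \<in> carrier_mat n d" and X': "X' \<in> carrier_mat n' d"
    and W: "WQ a \<in> carrier_mat d dh" "WK a \<in> carrier_mat d dh"
    and u: "u < n" "u' < n'" and row: "row X u = row X' u'"
    and ms: "image_mset (\<lambda>w. (\<psi> u w, row X w)) (mset_set {..<n}) =
      image_mset (\<lambda>w. (\<psi>' u' w, row X' w)) (mset_set {..<n'})"
  shows "row (RPE_attention \<psi> f1 f2 t h (scores dh a X) * X) u =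
    row (RPE_attention \<psi>' f1 f2 t h (scores dh a X') * X') u'"
proof (rule eq_vecI)
  let ?A = "RPE_attention \<psi> f1 f2 t h (scores dh a X)"
  let ?A' = "RPE_attention \<psi>' f1 f2 t h (scores dh a X')"
  have A: "?A \<in> carrier_mat n n" "?A' \<in> carrier_mat n' n'"
    by (rule RPE_attention_carrier[OF X W], rule RPE_attention_carrier[OF X' W])
  let ?w = "rpe_weight dh a (f2 t h) (row X u)"
  define D where "D = (\<Sum>w<n. ?w (\<psi> u w, row X w))"
  have D': "D = (\<Sum>w<n'. ?w (\<psi>' u' w, row X' w))"
    unfolding D_def by (rule sum_eq_if_image_mset_eq[OF ms])
  fix j assume "j < dim_vec (row (?A' * X') u')"
  then have j: "j < d" using X' by simp
  define F where "F = (\<lambda>(e, y). f1 t h e * (?w (e, y) / D) * (y $ j))"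
  have "row (?A * X) u $ j = (\<Sum>w<n. F (\<psi> u w, row X w))"
    using X u j A(1) RPE_attention_entry[OF X W u(1), of _ \<psi> f1 f2 t h]
    by (auto simp: F_def D_def scalar_prod_def lessThan_atLeast0 intro!: sum.cong)
  also have "\<dots> = (\<Sum>w<n'. F (\<psi>' u' w, row X' w))"
    by (rule sum_eq_if_image_mset_eq[OF ms])
  also have "\<dots> = row (?A' * X') u' $ j"
    using X' u j A(2) RPE_attention_entry[OF X' W u(2), of _ \<psi>' f1 f2 t h]
    by (auto simp: F_def D' row scalar_prod_def lessThan_atLeast0 intro!: sum.cong)
  finally show "row (?A * X) u $ j = row (?A' * X') u' $ j" .
qed (use X X' in simp)

lemma foldr_mat_add_carrier:
  assumes "\<And>h. h \<in> set hs \<Longrightarrow> M h \<in> carrier_mat n d" "Z \<in> carrier_mat n d"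
  shows "foldr (+) (map M hs) Z \<in> carrier_mat n d"
  using assms by (induction hs) auto

lemma row_foldr_mat_add_eq:
  assumes "\<And>h. h \<in> set hs \<Longrightarrow> M h \<in> carrier_mat n d" "\<And>h. h \<in> set hs \<Longrightarrow> M' h \<in> carrier_mat n' d"
    and "\<And>h. h \<in> set hs \<Longrightarrow> row (M h) u = row (M' h) u'" "u < n" "u' < n'"
  shows "row (foldr (+) (map M hs) (0\<^sub>m n d)) u = row (foldr (+) (map M' hs) (0\<^sub>m n' d)) u'"
  using assms
proof (induction hs)
  case (Cons h hs)
  show ?case unfolding list.map foldr.simps o_apply
    by (rule row_add_eq[of _ _ _ _ _ _ n d n']) (use Cons in \<open>auto simp del: row_add intro!: foldr_mat_add_carrier\<close>)
qed auto

context
  fixes T :: transformer and t :: nat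
  assumes T: "transformer_wf T" and t: "t < nlayers T"
begin

lemma layer_dims:
  "h < nheads T \<Longrightarrow> WQ (heads (params T t) h) \<in> carrier_mat (width T) (head_dim T)"
  "h < nheads T \<Longrightarrow> WK (heads (params T t) h) \<in> carrier_mat (width T) (head_dim T)"
  "h < nheads T \<Longrightarrow> WV (heads (params T t) h) \<in> carrier_mat (width T) (head_dim T)"
  "WO (params T t) \<in> carrier_mat (head_dim T) (width T)"
  "W1 (params T t) \<in> carrier_mat (width T) (hidden_dim T)"
  "W2 (params T t) \<in> carrier_mat (hidden_dim T) (width T)"
  using T t by (auto simp: transformer_wf_def)

lemma heads_sum_carrier:
  assumes "X \<in> carrier_mat n (width T)" "\<And>h. h < nheads T \<Longrightarrow> B h \<in> carrier_mat n n"
  shows "foldr (+) (map (\<lambda>h. B h * X * WV (heads (params T t) h)) [0..<nheads T]) (0\<^sub>m n (head_dim T))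
    \<in> carrier_mat n (head_dim T)"
  using assms layer_dims(3) by (intro foldr_mat_add_carrier) (auto intro!: mult_carrier_mat)

lemma transformer_layer_carrier:
  assumes X: "X \<in> carrier_mat n (width T)"
    and att: "\<And>h. h < nheads T \<Longrightarrow>
      att t h (scores (head_dim T) (heads (params T t) h) X) \<in> carrier_mat n n"
  shows "transformer_layer act T att t X \<in> carrier_mat n (width T)"
proof -
  have "dim_row X = n" using X by simp
  then show ?thesis
    unfolding transformer_layer_def Let_def
    using layer_dims(4-6) X heads_sum_carrier[OF X att]
    by (intro add_carrier_mat mult_carrier_mat[of _ _ "hidden_dim T"])
      (auto intro!: mult_carrier_mat add_carrier_mat)
qed

text \<open>Attention is the only place where rows mix; the projections, residual additions and the
  feed-forward part act on each row separately and preserve equality of rows.\<close>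

lemma row_RPE_transformer_layer:
  fixes \<psi> \<psi>' :: "nat \<Rightarrow> nat \<Rightarrow> 'e"
  assumes X: "X \<in> carrier_mat n (width T)" and X': "X' \<in> carrier_mat n' (width T)"
    and u: "u < n" "u' < n'" and row: "row X u = row X' u'"
    and ms: "image_mset (\<lambda>w. (\<psi> u w, row X w)) (mset_set {..<n}) =
      image_mset (\<lambda>w. (\<psi>' u' w, row X' w)) (mset_set {..<n'})"
  shows "row (transformer_layer act T (RPE_attention \<psi> f1 f2) t X) u =
    row (transformer_layer act T (RPE_attention \<psi>' f1 f2) t X') u'"
proof -
  let ?L = "params T t"
  define B where "B \<psi> X h = RPE_attention \<psi> f1 f2 t h (scores (head_dim T) (heads ?L h) X)"
    for \<psi> :: "nat \<Rightarrow> nat \<Rightarrow> 'e" and X h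
  define Z where "Z \<psi> X n = foldr (+) (map (\<lambda>h. B \<psi> X h * X * WV (heads ?L h)) [0..<nheads T]) (0\<^sub>m n (head_dim T))"
    for \<psi> :: "nat \<Rightarrow> nat \<Rightarrow> 'e" and X n
  define Y where "Y \<psi> X n = X + Z \<psi> X n * WO ?L" for \<psi> :: "nat \<Rightarrow> nat \<Rightarrow> 'e" and X n
  have out: "transformer_layer act T (RPE_attention \<psi> f1 f2) t X =
      Y \<psi> X n + map_mat act (Y \<psi> X n * W1 ?L) * W2 ?L"
    if "dim_row X = n" for \<psi> :: "nat \<Rightarrow> nat \<Rightarrow> 'e" and X n
    by (simp add: transformer_layer_def Let_def Y_def Z_def B_def that)
  have Bc: "B \<psi> X h \<in> carrier_mat n n"
    if "X \<in> carrier_mat n (width T)" "h < nheads T" for \<psi> :: "nat \<Rightarrow> nat \<Rightarrow> 'e" and X n h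
    unfolding B_def by (rule RPE_attention_carrier[OF that(1) layer_dims(1,2)[OF that(2)]])
  have Zc: "Z \<psi> X n \<in> carrier_mat n (head_dim T)"
    if "X \<in> carrier_mat n (width T)" for \<psi> :: "nat \<Rightarrow> nat \<Rightarrow> 'e" and X n
    unfolding Z_def by (rule heads_sum_carrier[OF that Bc[OF that]])
  have Yc: "Y \<psi> X n \<in> carrier_mat n (width T)"
    if "X \<in> carrier_mat n (width T)" for \<psi> :: "nat \<Rightarrow> nat \<Rightarrow> 'e" and X n
    unfolding Y_def using Zc[OF that] layer_dims that by (intro add_carrier_mat mult_carrier_mat) auto
  have rZ: "row (Z \<psi> X n) u = row (Z \<psi>' X' n') u'"
    unfolding Z_def
  proof (rule row_foldr_mat_add_eq[OF _ _ _ u])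
    fix h assume "h \<in> set [0..<nheads T]"
    then have h: "h < nheads T" by simp
    have "row (B \<psi> X h * X) u = row (B \<psi>' X' h * X') u'"
      unfolding B_def
      by (rule row_RPE_attention_mult[where \<psi>=\<psi> and \<psi>'=\<psi>', OF X X' layer_dims(1,2)[OF h] u row ms])
    then show "row (B \<psi> X h * X * WV (heads ?L h)) u = row (B \<psi>' X' h * X' * WV (heads ?L h)) u'"
      by (rule row_mult_eq) (use Bc[OF X h, of \<psi>] Bc[OF X' h, of \<psi>'] u in simp_all)
    show "B \<psi> X h * X * WV (heads ?L h) \<in> carrier_mat n (head_dim T)"
      "B \<psi>' X' h * X' * WV (heads ?L h) \<in> carrier_mat n' (head_dim T)"
      using X X' Bc[OF X h] Bc[OF X' h] layer_dims(3)[OF h] by (auto intro!: mult_carrier_mat)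
  qed
  have rY: "row (Y \<psi> X n) u = row (Y \<psi>' X' n') u'"
    unfolding Y_def
    by (rule row_add_eq[OF row row_mult_eq[OF rZ] X _ X'])
      (use u Zc[OF X, of \<psi>] Zc[OF X', of \<psi>'] layer_dims(4) in auto)
  note YY = Yc[OF X, of \<psi>] Yc[OF X', of \<psi>']
  have "row (Y \<psi> X n * W1 ?L) u = row (Y \<psi>' X' n' * W1 ?L) u'"
    by (rule row_mult_eq[OF rY]) (use YY u in auto)
  then have "row (map_mat act (Y \<psi> X n * W1 ?L)) u = row (map_mat act (Y \<psi>' X' n' * W1 ?L)) u'"
    by (rule row_map_mat_eq) (use YY u in auto)
  then have r: "row (map_mat act (Y \<psi> X n * W1 ?L) * W2 ?L) u =
      row (map_mat act (Y \<psi>' X' n' * W1 ?L) * W2 ?L) u'"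
    by (rule row_mult_eq) (use YY u in auto)
  have dX: "dim_row X = n" "dim_row X' = n'" using X X' by auto
  show ?thesis
    unfolding out[OF dX(1)] out[OF dX(2)]
    by (rule row_add_eq[OF rY r YY(1) _ YY(2) _ u]) (use YY layer_dims(6) in auto)
qed

end

lemma RPE_transformer_state_carrier:
  assumes T: "transformer_wf T" and X: "X \<in> carrier_mat n (width T)" and "t \<le> nlayers T"
  shows "transformer_state act T (RPE_attention \<psi> f1 f2) X t \<in> carrier_mat n (width T)"
  using assms(3)
proof (induction t)
  case (Suc t)
  then have t: "t < nlayers T" by simp
  show ?case
    unfolding transformer_state.simps
    using Suc by (intro transformer_layer_carrier[OF T t] RPE_attention_carrier layer_dims[OF T t]) (auto simp: layer_dims[OF T t])
qed (use X in simp)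

section \<open>Resistance distance and the Laplacian tensor\<close>

lemma laplacian_carrier [simp]: "laplacian G \<in> carrier_mat (nverts G) (nverts G)"
  by (intro carrier_matI) (simp_all add: laplacian_def degree_mat_def Defs.adj_mat_def mat_diag_def)

lemma laplacian_dim [simp]: "dim_row (laplacian G) = nverts G" "dim_col (laplacian G) = nverts G"
  using carrier_matD[OF laplacian_carrier[of G]] by auto

lemma laplacian_entry:
  assumes "u < nverts G" "v < nverts G"
  shows "laplacian G $$ (u, v) =
    (if u = v then real (vertex_degree G u) else 0) - (if edge G u v then 1 else 0)"
  using assms by (simp add: laplacian_def degree_mat_def Defs.adj_mat_def mat_diag_def)

lemma laplacian_symmetric:
  assumes "simple_graph G"
  shows "transpose_mat (laplacian G) = laplacian G"
proof (rule eq_matI)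
  fix u v assume "u < dim_row (laplacian G)" "v < dim_col (laplacian G)"
  then have "u < nverts G" "v < nverts G" by auto
  moreover have "edge G u v \<longleftrightarrow> edge G v u" using assms by (auto simp: simple_graph_def)
  ultimately show "transpose_mat (laplacian G) $$ (u, v) = laplacian G $$ (u, v)"
    by (simp add: laplacian_entry)
qed simp_all

section \<open>Relabelling of vertices and invariance of the pseudoinverse\<close>

definition relabel :: "(nat \<Rightarrow> nat) \<Rightarrow> nat \<Rightarrow> real mat \<Rightarrow> real mat" where
  "relabel \<pi> n A = mat n n (\<lambda>(u, v). A $$ (\<pi> u, \<pi> v))"

lemma relabel_mult:
  assumes \<pi>: "bij_betw \<pi> {..<n} {..<m}" and A: "A \<in> carrier_mat m m" "B \<in> carrier_mat m m"
  shows "relabel \<pi> n A * relabel \<pi> n B = relabel \<pi> n (A * B)"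
proof (rule eq_matI)
  fix u v assume "u < dim_row (relabel \<pi> n (A * B))" "v < dim_col (relabel \<pi> n (A * B))"
  then have uv: "u < n" "v < n" by (auto simp: relabel_def)
  then have p: "\<pi> u < m" "\<pi> v < m" using \<pi> by (auto simp: bij_betw_def)
  have "(relabel \<pi> n A * relabel \<pi> n B) $$ (u, v) = (\<Sum>w<n. A $$ (\<pi> u, \<pi> w) * B $$ (\<pi> w, \<pi> v))"
    using uv by (simp add: relabel_def scalar_prod_def lessThan_atLeast0)
  also have "\<dots> = (\<Sum>w<m. A $$ (\<pi> u, w) * B $$ (w, \<pi> v))"
    by (rule sum.reindex_bij_betw[OF \<pi>])
  also have "\<dots> = relabel \<pi> n (A * B) $$ (u, v)"
    using uv p A by (simp add: relabel_def scalar_prod_def lessThan_atLeast0)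
  finally show "(relabel \<pi> n A * relabel \<pi> n B) $$ (u, v) = relabel \<pi> n (A * B) $$ (u, v)" .
qed (simp_all add: relabel_def)

lemma relabel_transpose:
  assumes \<pi>: "bij_betw \<pi> {..<n} {..<m}" and A: "A \<in> carrier_mat m m"
  shows "transpose_mat (relabel \<pi> n A) = relabel \<pi> n (transpose_mat A)"
proof (rule eq_matI)
  fix u v assume "u < dim_row (relabel \<pi> n (transpose_mat A))" "v < dim_col (relabel \<pi> n (transpose_mat A))"
  then have uv: "u < n" "v < n" by (auto simp: relabel_def)
  then have "\<pi> u < m" "\<pi> v < m" using \<pi> by (auto simp: bij_betw_def)
  then show "transpose_mat (relabel \<pi> n A) $$ (u, v) = relabel \<pi> n (transpose_mat A) $$ (u, v)"
    using uv A by (simp add: relabel_def)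
qed (simp_all add: relabel_def)

lemma is_pseudoinverse_relabel:
  assumes \<pi>: "bij_betw \<pi> {..<n} {..<m}" and M: "M \<in> carrier_mat m m" and P: "is_pseudoinverse M P"
  shows "is_pseudoinverse (relabel \<pi> n M) (relabel \<pi> n P)"
proof -
  have c: "P \<in> carrier_mat m m" using M P by (auto simp: is_pseudoinverse_def)
  have c': "M * P \<in> carrier_mat m m" "P * M \<in> carrier_mat m m" using M c by auto
  have "relabel \<pi> n P \<in> carrier_mat (dim_col (relabel \<pi> n M)) (dim_row (relabel \<pi> n M))"
    by (simp add: relabel_def)
  then show ?thesis
    using P unfolding is_pseudoinverse_def
    by (simp add: relabel_mult[OF \<pi>] relabel_transpose[OF \<pi>] M c c' del: assoc_mult_mat)
qed

lemma relabel_laplacian: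
  assumes \<pi>: "graph_iso \<pi> G H"
  shows "relabel \<pi> (nverts G) (laplacian H) = laplacian G"
proof (rule eq_matI)
  have bij: "bij_betw \<pi> {..<nverts G} {..<nverts H}"
    and edge: "\<And>u v. u < nverts G \<Longrightarrow> v < nverts G \<Longrightarrow> edge G u v \<longleftrightarrow> edge H (\<pi> u) (\<pi> v)"
    using \<pi> by (auto simp: graph_iso_def)
  have lt: "\<pi> u < nverts H" if "u < nverts G" for u
    using bij that by (auto simp: bij_betw_def)
  have deg: "vertex_degree G u = vertex_degree H (\<pi> u)" if u: "u < nverts G" for u
  proof -
    have "bij_betw \<pi> {v. v < nverts G \<and> edge G u v} {v. v < nverts H \<and> edge H (\<pi> u) v}"
    proof (rule bij_betw_imageI)
      show "inj_on \<pi> {v. v < nverts G \<and> edge G u v}"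
        by (rule inj_on_subset[OF bij_betw_imp_inj_on[OF bij]]) auto
      show "\<pi> ` {v. v < nverts G \<and> edge G u v} = {v. v < nverts H \<and> edge H (\<pi> u) v}"
      proof (intro subset_antisym subsetI)
        fix v assume v: "v \<in> {v. v < nverts H \<and> edge H (\<pi> u) v}"
        then obtain w where "w < nverts G" "v = \<pi> w"
          using bij unfolding bij_betw_def by blast
        then show "v \<in> \<pi> ` {v. v < nverts G \<and> edge G u v}" using v edge[OF u] by blast
      qed (use lt edge[OF u] in auto)
    qed
    then show ?thesis unfolding vertex_degree_def by (rule bij_betw_same_card)
  qed
  fix u v assume "u < dim_row (laplacian G)" "v < dim_col (laplacian G)"
  then have uv: "u < nverts G" "v < nverts G" by auto
  have "\<pi> u = \<pi> v \<longleftrightarrow> u = v"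
    using inj_on_eq_iff[OF bij_betw_imp_inj_on[OF bij]] uv by simp
  then show "relabel \<pi> (nverts G) (laplacian H) $$ (u, v) = laplacian G $$ (u, v)"
    using uv lt deg edge by (simp add: relabel_def laplacian_entry)
qed (simp_all add: relabel_def)

lemma is_pseudoinverse_laplacian:
  "simple_graph G \<Longrightarrow> is_pseudoinverse (laplacian G) (pseudoinverse (laplacian G))"
  by (rule is_pseudoinverse_pseudoinverse[OF laplacian_carrier laplacian_symmetric])

text \<open>The relabelled pseudoinverse of the Laplacian of \<open>H\<close> satisfies the
  Moore-Penrose conditions for that of \<open>G\<close>; uniqueness identifies the two.\<close>

lemma pseudoinverse_laplacian_iso:
  assumes "simple_graph H" "graph_iso \<pi> G H" "u < nverts G" "v < nverts G"
  shows "pseudoinverse (laplacian G) $$ (u, v) = pseudoinverse (laplacian H) $$ (\<pi> u, \<pi> v)"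
proof -
  have "bij_betw \<pi> {..<nverts G} {..<nverts H}" using assms(2) by (simp add: graph_iso_def)
  from is_pseudoinverse_relabel[OF this laplacian_carrier is_pseudoinverse_laplacian[OF assms(1)]]
  have "pseudoinverse (laplacian G) = relabel \<pi> (nverts G) (pseudoinverse (laplacian H))"
    unfolding relabel_laplacian[OF assms(2)] by (rule pseudoinverse_eqI)
  then show ?thesis using assms(3,4) by (simp add: relabel_def)
qed

text \<open>Expressed by the pseudoinverse instead of an eigenbasis, the input of \<open>g\<close>
  visibly depends on the graph alone.\<close>

definition laplacian_tensor :: "graph \<Rightarrow> tensor" where
  "laplacian_tensor G = stack (1\<^sub>m (nverts G)) (pseudoinverse (laplacian G))"

lemma APE_laplacian_tensor:
  assumes g: "egn_wf 2 l g"
  shows "APE l (\<lambda>G. apply_egn act g (nverts G) (laplacian_tensor G))"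
  unfolding APE_def
proof (intro conjI allI impI)
  fix G
  show "apply_egn act g (nverts G) (laplacian_tensor G) \<in> carrier_mat (nverts G) l"
    using g by (simp add: apply_egn_def egn_wf_def Let_def)
next
  fix G H \<pi> u
  assume H: "simple_graph H" and \<pi>: "graph_iso \<pi> G H" and u: "u < nverts G"
  have bij: "bij_betw \<pi> {..<nverts G} {..<nverts H}" using \<pi> by (simp add: graph_iso_def)
  show "row (apply_egn act g (nverts G) (laplacian_tensor G)) u =
      row (apply_egn act g (nverts H) (laplacian_tensor H)) (\<pi> u)"
  proof (rule apply_egn_equivariant[OF g bij _ u])
    fix u v assume uv: "u < nverts G" "v < nverts G"
    then have "\<pi> u < nverts H" "\<pi> v < nverts H" using bij by (auto simp: bij_betw_def)
    moreover have "\<pi> u = \<pi> v \<longleftrightarrow> u = v"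
      using inj_on_eq_iff[OF bij_betw_imp_inj_on[OF bij]] uv by simp
    ultimately show "laplacian_tensor G [u, v] = laplacian_tensor H [\<pi> u, \<pi> v]"
      using uv pseudoinverse_laplacian_iso[OF H \<pi> uv] by (simp add: laplacian_tensor_def stack_def)
  qed
qed

lemma diag_aug_SPE_laplacian_tensor:
  assumes "egn_wf 2 l g"
  shows "diag_aug_SPE act (\<lambda>\<Lambda>. vec (dim_vec \<Lambda>) (\<lambda>i. inverse (\<Lambda> $ i))) l
    (\<lambda>G. apply_egn act g (nverts G) (laplacian_tensor G))"
  unfolding diag_aug_SPE_def laplacian_tensor_def
  using assms pseudoinverse_eqI[OF eigendecomposition_is_pseudoinverse[OF laplacian_carrier]]
  by (intro exI[of _ g]) auto

lemma deepsets_pointwise: "deepsets (\<lambda>\<Lambda>. vec (dim_vec \<Lambda>) (\<lambda>i. h (\<Lambda> $ i)))"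
  unfolding deepsets_def
  \<comment> \<open>An entrywise function is the case of a zero-dimensional pooled vector.\<close>
  by (intro exI[of _ 0] exI[of _ "\<lambda>_. 0\<^sub>v 0"] exI[of _ "\<lambda>x _. h x"]) simp

text \<open>Channel 1 of readouts 0, 1 and 2 holds exactly the three pseudoinverse entries in the
  formula for the resistance distance. The states are assumed constant, as they are for unfeatured
  graphs before the first layer.\<close>

lemma context_determines_RD:
  fixes s :: "graph \<Rightarrow> nat \<Rightarrow> 's"
  assumes s: "\<And>G u H v. G \<in> \<K> \<Longrightarrow> H \<in> \<K> \<Longrightarrow> u < nverts G \<Longrightarrow> v < nverts H \<Longrightarrow> s G u = s H v"
  shows "context_determines \<K> nverts (\<lambda>G. context_vec (nverts G) 2 (laplacian_tensor G)) RD s"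
  unfolding context_determines_def
proof (intro ballI allI impI conjI)
  fix G H u u' v v'
  assume GH: "G \<in> \<K>" "H \<in> \<K>" and u: "u < nverts G" "u' < nverts H" and v: "v < nverts G" "v' < nverts H"
    and eq: "context_vec (nverts G) 2 (laplacian_tensor G) u v =
      context_vec (nverts H) 2 (laplacian_tensor H) u' v'"
  have "laplacian_tensor K [x, y] $ 1 = pseudoinverse (laplacian K) $$ (x, y)" for K x y
    by (simp add: laplacian_tensor_def stack_def)
  then show "RD G u v = RD H u' v'"
    using context_vec_eqD[OF eq, of 0 1] context_vec_eqD[OF eq, of 1 1] context_vec_eqD[OF eq, of 2 1]
      readout_simps(1-3)[OF u(1) v(1)] readout_simps(1-3)[OF u(2) v(2)]
    by (simp add: RD_def Let_def)
  show "s G u = s H u'" "s G v = s H v'" by (rule s[OF GH u], rule s[OF GH v])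
qed

text \<open>The states to be refined are the rows of the RPE-GT after \<open>t\<close> layers, one
  round of refinement per transformer layer.\<close>

lemma exists_egn_determining_RPE_GT:
  assumes act: "nonpolynomial_activation act" and fin: "finite \<K>" and T: "transformer_wf T"
  shows "\<exists>l g. egn_wf 2 l g \<and> (\<forall>G\<in>\<K>. \<forall>H\<in>\<K>. \<forall>u<nverts G. \<forall>v<nverts H.
    row (apply_egn act g (nverts G) (laplacian_tensor G)) u =
      row (apply_egn act g (nverts H) (laplacian_tensor H)) v \<longrightarrow>
    row (run_transformer act' T (RPE_attention (RD G) f1 f2) (const_features G (width T))) u =
      row (run_transformer act' T (RPE_attention (RD H) f1 f2) (const_features H (width T))) v)"
proof -
  define X where "X t G = transformer_state act' T (RPE_attention (RD G) f1 f2) (const_features G (width T)) t"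
    for t G
  have Xc: "X t G \<in> carrier_mat (nverts G) (width T)" if "t \<le> nlayers T" for t G
    unfolding X_def by (rule RPE_transformer_state_carrier[OF T _ that]) (simp add: const_features_def)
  have "\<exists>l g. egn_wf 2 l g \<and> (\<forall>G\<in>\<K>. \<forall>H\<in>\<K>. \<forall>u<nverts G. \<forall>v<nverts H.
    row (apply_egn act g (nverts G) (laplacian_tensor G)) u =
      row (apply_egn act g (nverts H) (laplacian_tensor H)) v \<longrightarrow>
    row (X (nlayers T) G) u = row (X (nlayers T) H) v)"
  proof (rule egn_computes_refinement[OF act fin, where \<psi>=RD and \<kappa>=1])
    show "context_determines \<K> nverts (\<lambda>G. context_vec (nverts G) 2 (laplacian_tensor G)) RD
        (\<lambda>G u. row (X 0 G) u)"
      by (rule context_determines_RD) (auto simp: X_def const_features_def)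
  next
    fix t assume t: "t < nlayers T"
    show "refinement_determines \<K> nverts RD (\<lambda>G u. row (X t G) u) (\<lambda>G u. row (X (Suc t) G) u)"
      unfolding refinement_determines_def
    proof (intro ballI allI impI)
      fix G H u v
      assume uv: "u < nverts G" "v < nverts H" and row: "row (X t G) u = row (X t H) v"
        and ms: "image_mset (\<lambda>w. (RD G u w, row (X t G) w)) (mset_set {..<nverts G}) =
          image_mset (\<lambda>w. (RD H v w, row (X t H) w)) (mset_set {..<nverts H})"
      have "X (Suc t) K = transformer_layer act' T (RPE_attention (RD K) f1 f2) t (X t K)" for K
        by (simp add: X_def)
      then show "row (X (Suc t) G) u = row (X (Suc t) H) v"
        using row_RPE_transformer_layer[OF T t Xc Xc uv row, where \<psi>="RD G" and \<psi>'="RD H", OF _ _ ms] t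
        by simp
    qed
  qed (auto simp: laplacian_tensor_def stack_def)
  then show ?thesis by (simp add: X_def run_transformer_def)
qed

theorem theorem4p4:
  shows "\<exists>f. deepsets f \<and>
    (\<forall>act_egn act_gt G H.
       nonpolynomial_activation act_egn \<longrightarrow> simple_graph G \<longrightarrow> simple_graph H \<longrightarrow>
       (\<forall>l \<phi>. APE l \<phi> \<longrightarrow> diag_aug_SPE act_egn f l \<phi> \<longrightarrow>
          APE_GT_indistinguishable act_gt l \<phi> G H) \<longrightarrow>
       RPE_GT_indistinguishable act_gt RD G H)"
proof (intro exI conjI allI impI)
  show "deepsets (\<lambda>\<Lambda>. vec (dim_vec \<Lambda>) (\<lambda>i. inverse (\<Lambda> $ i)))"
    by (rule deepsets_pointwise)
next
  fix act_egn act_gt :: "real \<Rightarrow> real" and G H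
  assume act: "nonpolynomial_activation act_egn"
    and ind: "\<forall>l \<phi>. APE l \<phi> \<longrightarrow>
      diag_aug_SPE act_egn (\<lambda>\<Lambda>. vec (dim_vec \<Lambda>) (\<lambda>i. inverse (\<Lambda> $ i))) l \<phi> \<longrightarrow>
      APE_GT_indistinguishable act_gt l \<phi> G H"
  show "RPE_GT_indistinguishable act_gt RD G H"
    unfolding RPE_GT_indistinguishable_def
  proof (intro allI impI)
    fix T f1 f2 assume T: "transformer_wf T"
    let ?out = "\<lambda>K. run_transformer act_gt T (RPE_attention (RD K) f1 f2) (const_features K (width T))"
    \<comment> \<open>Separation is needed within each graph as well as between the two, so that a
      single function maps rows of the APE to rows of the RPE-GT.\<close>
    have "finite {G, H}" by simp
    from exists_egn_determining_RPE_GT[OF act this T, of act_gt f1 f2]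
    obtain l g where g: "egn_wf 2 l g" and det: "\<forall>K\<in>{G, H}. \<forall>K'\<in>{G, H}. \<forall>u<nverts K. \<forall>v<nverts K'.
        row (apply_egn act_egn g (nverts K) (laplacian_tensor K)) u =
          row (apply_egn act_egn g (nverts K') (laplacian_tensor K')) v \<longrightarrow>
        row (?out K) u = row (?out K') v"
      by blast
    define \<phi> where "\<phi> K = apply_egn act_egn g (nverts K) (laplacian_tensor K)" for K
    let ?A = "\<lambda>K. concat_cols (const_features K 1) (\<phi> K)"
    have \<phi>: "\<phi> K \<in> carrier_mat (nverts K) l" for K
      using g by (simp add: \<phi>_def apply_egn_def egn_wf_def Let_def)
    have dimA: "dim_row (?A K) = nverts K" for K by (simp add: concat_cols_def const_features_def)
    have "APE_GT_indistinguishable act_gt l \<phi> G H"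
      using ind APE_laplacian_tensor[OF g] diag_aug_SPE_laplacian_tensor[OF g]
      unfolding \<phi>_def[abs_def] by blast
    then have "same_rows (?A G) (?A H)" by (rule same_rows_if_APE_GT_indistinguishable)
    then show "same_rows (?out G) (?out H)"
    proof (rule same_rows_if_rows_determine)
      fix K
      have "?out K \<in> carrier_mat (nverts K) (width T)"
        unfolding run_transformer_def
        by (rule RPE_transformer_state_carrier[OF T]) (simp_all add: const_features_def)
      then show "dim_row (?out K) = dim_row (?A K)" by (simp add: dimA del: One_nat_def)
    next
      fix K K' u v
      assume K: "K \<in> {G, H}" "K' \<in> {G, H}" and "u < dim_row (?A K)" "v < dim_row (?A K')"
        and eq: "row (?A K) u = row (?A K') v"
      then have uv: "u < nverts K" "v < nverts K'" by (simp_all add: dimA del: One_nat_def)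
      \<comment> \<open>Column 0 of the concatenation is the constant node feature, hence the shift
        by one.\<close>
      have entry: "row (?A L) w $ Suc j = row (\<phi> L) w $ j" if "w < nverts L" "j < l" for L w j
        using that \<phi>[of L] by (simp add: concat_cols_def const_features_def)
      have "row (\<phi> K) u = row (\<phi> K') v"
      proof (rule eq_vecI)
        fix j assume "j < dim_vec (row (\<phi> K') v)"
        then have j: "j < l" using \<phi>[of K'] by simp
        show "row (\<phi> K) u $ j = row (\<phi> K') v $ j"
          using entry[OF uv(1) j] entry[OF uv(2) j] eq by simp
      qed (use \<phi>[of K] \<phi>[of K'] in simp)
      then show "row (?out K) u = row (?out K') v"
        unfolding \<phi>_def by (rule det[rule_format, OF K uv])
    qed
  qed
qed

end
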